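(* For every (unital, commutative) quantale $\mathcal V=(\mathcal V,\le,\otimes,\mathrm k)$, the category $\mathsf{Cat}/\!/\mathcal V$ of small $\mathcal V$-normed categories and $\mathcal V$-normed functors is locally presentable.
   Context: A quantale $(\mathcal V,\le,\otimes,\mathrm k)$ is a complete lattice (with underlying set small) with a commutative monoid structure $(\mathcal V,\otimes,\mathrm k)$ such that each $-\otimes v$ preserves arbitrary joins. A $\mathcal V$-normed category is a category $\mathbb X$ with a value $|f|\in\mathcal V$ for every morphism $f$ such that $\mathrm k\le|1_x|$ and $|f|\otimes|g|\le|g\cdot f|$ for all objects $x$ and composable $f:x\to y$, $g:y\to z$. Equivalently, it is a category enriched in the symmetric monoidal-closed category $\mathsf{Set}/\!/\mathcal V$ of sets $A$ with a function $|\cdot|:A\to\mathcal V$ and maps $f$ satisfying $|a|\le|fa|$. A functor $F$ between $\mathcal V$-normed categories is $\mathcal V$-normed if $|f|\le|Ff|$ for all morphisms $f$. *)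

theory Defs
  imports Main "HOL-Library.FuncSet"
begin

unbundle cardinal_syntax

section \<open>Universes and smallness\<close>

text \<open>
  HOL has no type of all sets, so smallness is relative to a Grothendieck universe, which is given
  by a type \<^typ>\<open>'u\<close> of strongly inaccessible cardinality. A set (of elements of any type) is small
  if its cardinality is less than that of \<^typ>\<open>'u\<close>; up to a bijection between \<^typ>\<open>'u\<close> and the
  universe, the small subsets of \<^typ>\<open>'u\<close> are precisely the elements of the universe.
\<close>

definition universe :: "'u itself \<Rightarrow> bool" where
  "universe U \<longleftrightarrow>
     natLeq <o |UNIV :: 'u set| \<and>
     regularCard |UNIV :: 'u set| \<and>
     (\<forall>A :: 'u set. |A| <o |UNIV :: 'u set| \<longrightarrow> |Pow A| <o |UNIV :: 'u set| )"

definition small :: "'u itself \<Rightarrow> 'a set \<Rightarrow> bool" where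
  "small U A \<longleftrightarrow> |A| <o |UNIV :: 'u set|"


section \<open>Categories and functors\<close>

record ('o, 'a) cat =
  Obj :: "'o set"
  Arr :: "'a set"
  Dom :: "'a \<Rightarrow> 'o"
  Cod :: "'a \<Rightarrow> 'o"
  Id :: "'o \<Rightarrow> 'a"
  Comp :: "'a \<Rightarrow> 'a \<Rightarrow> 'a"  \<comment> \<open>\<open>Comp C g f\<close> is \<open>g\<close> after \<open>f\<close>\<close>

definition hom :: "('o, 'a, 'x) cat_scheme \<Rightarrow> 'o \<Rightarrow> 'o \<Rightarrow> 'a set" where
  "hom C x y = {f \<in> Arr C. Dom C f = x \<and> Cod C f = y}"

locale category =
  fixes C :: "('o, 'a, 'x) cat_scheme"
  assumes Dom_in: "f \<in> Arr C \<Longrightarrow> Dom C f \<in> Obj C"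
    and Cod_in: "f \<in> Arr C \<Longrightarrow> Cod C f \<in> Obj C"
    and Id_in: "x \<in> Obj C \<Longrightarrow> Id C x \<in> hom C x x"
    and Comp_in: "f \<in> hom C x y \<Longrightarrow> g \<in> hom C y z \<Longrightarrow> Comp C g f \<in> hom C x z"
    and Comp_Id: "f \<in> hom C x y \<Longrightarrow> Comp C f (Id C x) = f"
    and Id_Comp: "f \<in> hom C x y \<Longrightarrow> Comp C (Id C y) f = f"
    and Comp_assoc: "f \<in> hom C w x \<Longrightarrow> g \<in> hom C x y \<Longrightarrow> h \<in> hom C y z \<Longrightarrow>
      Comp C h (Comp C g f) = Comp C (Comp C h g) f"

record ('o, 'a, 'p, 'b) functor_map =
  ObjMap :: "'o \<Rightarrow> 'p"
  ArrMap :: "'a \<Rightarrow> 'b"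

locale is_functor = S: category C + T: category D
  for C :: "('o, 'a, 'x) cat_scheme" and D :: "('p, 'b, 'y) cat_scheme"
    and F :: "('o, 'a, 'p, 'b) functor_map" +
  assumes ObjMap_in: "x \<in> Obj C \<Longrightarrow> ObjMap F x \<in> Obj D"
    and ArrMap_in: "f \<in> hom C x y \<Longrightarrow> ArrMap F f \<in> hom D (ObjMap F x) (ObjMap F y)"
    and ArrMap_Id: "x \<in> Obj C \<Longrightarrow> ArrMap F (Id C x) = Id D (ObjMap F x)"
    and ArrMap_Comp: "f \<in> hom C x y \<Longrightarrow> g \<in> hom C y z \<Longrightarrow>
      ArrMap F (Comp C g f) = Comp D (ArrMap F g) (ArrMap F f)"

definition functor_comp ::
  "('p, 'b, 'q, 'c) functor_map \<Rightarrow> ('o, 'a, 'p, 'b) functor_map \<Rightarrow> ('o, 'a, 'q, 'c) functor_map" where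
  "functor_comp G F = \<lparr>ObjMap = ObjMap G \<circ> ObjMap F, ArrMap = ArrMap G \<circ> ArrMap F\<rparr>"

definition locally_small :: "'u itself \<Rightarrow> ('o, 'a, 'x) cat_scheme \<Rightarrow> bool" where
  "locally_small U C \<longleftrightarrow> (\<forall>x \<in> Obj C. \<forall>y \<in> Obj C. small U (hom C x y))"


section \<open>Colimits\<close>

definition is_cocone ::
  "('i, 'j, 'x) cat_scheme \<Rightarrow> ('o, 'a, 'y) cat_scheme \<Rightarrow> ('i, 'j, 'o, 'a) functor_map \<Rightarrow>
    'o \<Rightarrow> ('i \<Rightarrow> 'a) \<Rightarrow> bool" where
  "is_cocone J C D c t \<longleftrightarrow>
     c \<in> Obj C \<and>
     (\<forall>i \<in> Obj J. t i \<in> hom C (ObjMap D i) c) \<and>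
     (\<forall>u \<in> Arr J. Comp C (t (Cod J u)) (ArrMap D u) = t (Dom J u))"

definition is_colimit ::
  "('i, 'j, 'x) cat_scheme \<Rightarrow> ('o, 'a, 'y) cat_scheme \<Rightarrow> ('i, 'j, 'o, 'a) functor_map \<Rightarrow>
    'o \<Rightarrow> ('i \<Rightarrow> 'a) \<Rightarrow> bool" where
  "is_colimit J C D c t \<longleftrightarrow>
     is_cocone J C D c t \<and>
     (\<forall>c' t'. is_cocone J C D c' t' \<longrightarrow>
        (\<exists>!h. h \<in> hom C c c' \<and> (\<forall>i \<in> Obj J. Comp C h (t i) = t' i)))"

text \<open>Every small category is isomorphic to one with objects and arrows in \<^typ>\<open>'u\<close>.\<close>

definition cocomplete :: "'u itself \<Rightarrow> ('o, 'a, 'x) cat_scheme \<Rightarrow> bool" where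
  "cocomplete U C \<longleftrightarrow>
     (\<forall>(J :: ('u, 'u) cat) D.
        small U (Obj J) \<and> small U (Arr J) \<and> is_functor J C D \<longrightarrow> (\<exists>c t. is_colimit J C D c t))"

definition poset_cat :: "'i set \<Rightarrow> 'i rel \<Rightarrow> ('i, 'i \<times> 'i) cat" where
  "poset_cat P r =
     \<lparr>Obj = P, Arr = r, Dom = fst, Cod = snd, Id = (\<lambda>x. (x, x)), Comp = (\<lambda>g f. (fst f, snd g))\<rparr>"

text \<open>Taking \<open>S = {}\<close> shows that directed posets are nonempty.\<close>

definition directed_poset :: "'k rel \<Rightarrow> 'i set \<Rightarrow> 'i rel \<Rightarrow> bool" where
  "directed_poset lam P r \<longleftrightarrow>
     partial_order_on P r \<and>
     (\<forall>S \<subseteq> P. |S| <o lam \<longrightarrow> (\<exists>b \<in> P. \<forall>s \<in> S. (s, b) \<in> r))"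

definition preserves_directed_colimits ::
  "'u itself \<Rightarrow> 'k rel \<Rightarrow> ('o, 'a, 'x) cat_scheme \<Rightarrow> ('p, 'b, 'y) cat_scheme \<Rightarrow>
    ('o, 'a, 'p, 'b) functor_map \<Rightarrow> bool" where
  "preserves_directed_colimits U lam C E F \<longleftrightarrow>
     (\<forall>(P :: 'u set) r D c t.
        small U P \<and> directed_poset lam P r \<and> is_functor (poset_cat P r) C D \<and>
        is_colimit (poset_cat P r) C D c t \<longrightarrow>
        is_colimit (poset_cat P r) E (functor_comp F D) (ObjMap F c) (\<lambda>i. ArrMap F (t i)))"


section \<open>Locally presentable categories\<close>

text \<open>Arrows carry their domain and codomain; functions are extensional.\<close>

definition set_cat :: "'u itself \<Rightarrow> ('s set, 's set \<times> ('s \<Rightarrow> 's) \<times> 's set) cat" where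
  "set_cat U =
     \<lparr>Obj = {A. small U A},
      Arr = {(A, f, B). small U A \<and> small U B \<and> f \<in> A \<rightarrow>\<^sub>E B},
      Dom = (\<lambda>(A, f, B). A),
      Cod = (\<lambda>(A, f, B). B),
      Id = (\<lambda>A. (A, \<lambda>x\<in>A. x, A)),
      Comp = (\<lambda>(_, g, B') (A, f, _). (A, compose A g f, B'))\<rparr>"

text \<open>
  The hom-functor is to take values in the category of all small sets. Small subsets of the arrow
  type \<^typ>\<open>'a\<close> need not exhaust all small cardinalities, but those of \<^typ>\<open>'a + 'u\<close> do; hence
  the tag \<^const>\<open>Inl\<close>.
\<close>

definition hom_functor ::
  "'u itself \<Rightarrow> ('o, 'a, 'x) cat_scheme \<Rightarrow> 'o \<Rightarrow>
    ('o, 'a, ('a + 'u) set, ('a + 'u) set \<times> ('a + 'u \<Rightarrow> 'a + 'u) \<times> ('a + 'u) set) functor_map" where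
  "hom_functor U C K =
     \<lparr>ObjMap = (\<lambda>x. Inl ` hom C K x),
      ArrMap = (\<lambda>f. (Inl ` hom C K (Dom C f),
                     \<lambda>p \<in> Inl ` hom C K (Dom C f). Inl (Comp C f (projl p)),
                     Inl ` hom C K (Cod C f)))\<rparr>"

definition presentable_object ::
  "'u itself \<Rightarrow> 'k rel \<Rightarrow> ('o, 'a, 'x) cat_scheme \<Rightarrow> 'o \<Rightarrow> bool" where
  "presentable_object U lam C K \<longleftrightarrow>
     K \<in> Obj C \<and> preserves_directed_colimits U lam C (set_cat U) (hom_functor U C K)"

definition locally_presentable_for ::
  "'u itself \<Rightarrow> 'k rel \<Rightarrow> ('o, 'a, 'x) cat_scheme \<Rightarrow> bool" where
  "locally_presentable_for U lam C \<longleftrightarrow>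
     category C \<and> locally_small U C \<and> cocomplete U C \<and>
     (\<exists>A \<subseteq> Obj C.
        small U A \<and> (\<forall>K \<in> A. presentable_object U lam C K) \<and>
        (\<forall>x \<in> Obj C. \<exists>(P :: 'u set) r D t.
           small U P \<and> directed_poset lam P r \<and> is_functor (poset_cat P r) C D \<and>
           (\<forall>i \<in> P. ObjMap D i \<in> A) \<and> is_colimit (poset_cat P r) C D x t))"

text \<open>Every small cardinal is isomorphic to a cardinal order on a subset of \<^typ>\<open>'u\<close>.\<close>

definition locally_presentable :: "'u itself \<Rightarrow> ('o, 'a, 'x) cat_scheme \<Rightarrow> bool" where
  "locally_presentable U C \<longleftrightarrow>
     (\<exists>lam :: 'u rel.
        Cinfinite lam \<and> regularCard lam \<and> lam <o |UNIV :: 'u set| \<and>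
        locally_presentable_for U lam C)"


section \<open>Normed categories over a quantale\<close>

text \<open>The tensor product is written \<open>*\<close> and its neutral element \<open>1\<close>.\<close>

class quantale = complete_lattice + comm_monoid_mult +
  assumes Sup_mult: "Sup A * v = (SUP a\<in>A. a * v)"

record ('o, 'a, 'v) ncat = "('o, 'a) cat" +
  nrm :: "'a \<Rightarrow> 'v"

locale normed_category = category X
  for X :: "('o, 'a, 'v::quantale, 'x) ncat_scheme" +
  assumes nrm_Id: "x \<in> Obj X \<Longrightarrow> 1 \<le> nrm X (Id X x)"
    and nrm_Comp: "f \<in> hom X x y \<Longrightarrow> g \<in> hom X y z \<Longrightarrow> nrm X f * nrm X g \<le> nrm X (Comp X g f)"

locale normed_functor = is_functor X Y F + S: normed_category X + T: normed_category Y
  for X :: "('o, 'a, 'v::quantale, 'x) ncat_scheme"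
    and Y :: "('p, 'b, 'v, 'y) ncat_scheme"
    and F :: "('o, 'a, 'p, 'b) functor_map" +
  assumes nrm_ArrMap: "f \<in> Arr X \<Longrightarrow> nrm X f \<le> nrm Y (ArrMap F f)"

text \<open>
  The operations of a category are total functions. The two extensionality conditions below fix
  their values at irrelevant arguments, so that normed categories and functors with the same data
  are equal.
\<close>

definition extensional_ncat :: "('o, 'a, 'v) ncat \<Rightarrow> bool" where
  "extensional_ncat X \<longleftrightarrow>
     Dom X \<in> extensional (Arr X) \<and> Cod X \<in> extensional (Arr X) \<and> Id X \<in> extensional (Obj X) \<and>
     (\<forall>f g. \<not> (f \<in> Arr X \<and> g \<in> Arr X \<and> Cod X f = Dom X g) \<longrightarrow> Comp X g f = undefined) \<and>
     nrm X \<in> extensional (Arr X)"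

definition extensional_functor_map ::
  "('o, 'a, 'x) cat_scheme \<Rightarrow> ('o, 'a, 'p, 'b) functor_map \<Rightarrow> bool" where
  "extensional_functor_map X F \<longleftrightarrow>
     ObjMap F \<in> extensional (Obj X) \<and> ArrMap F \<in> extensional (Arr X)"

definition small_ncats :: "('u, 'u, 'v::quantale) ncat set" where
  "small_ncats =
     {X. normed_category X \<and> small TYPE('u) (Obj X) \<and> small TYPE('u) (Arr X) \<and> extensional_ncat X}"

definition Cat_normed ::
  "(('u, 'u, 'v::quantale) ncat,
    ('u, 'u, 'v) ncat \<times> ('u, 'u, 'u, 'u) functor_map \<times> ('u, 'u, 'v) ncat) cat" where
  "Cat_normed =
     \<lparr>Obj = small_ncats,
      Arr = {(X, F, Y). X \<in> small_ncats \<and> Y \<in> small_ncats \<and>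
                normed_functor X Y F \<and> extensional_functor_map X F},
      Dom = (\<lambda>(X, F, Y). X),
      Cod = (\<lambda>(X, F, Y). Y),
      Id = (\<lambda>X. (X, \<lparr>ObjMap = (\<lambda>x\<in>Obj X. x), ArrMap = (\<lambda>f\<in>Arr X. f)\<rparr>, X)),
      Comp = (\<lambda>(_, G, Z) (X, F, _).
                (X, \<lparr>ObjMap = compose (Obj X) (ObjMap G) (ObjMap F),
                     ArrMap = compose (Arr X) (ArrMap G) (ArrMap F)\<rparr>, Z))\<rparr>"

end

theory Submission
  imports Defs
begin

text \<open>
  A functor is determined by its map of arrows, so all constructions are made on arrows only.
  The colimit of a small diagram is the subcategory generated by the diagram in the product of
  all its cocones, with the infimum norm. For presentability let \<open>K\<close> be an infinite set at least as
  large as the quantale and let \<open>lam\<close> be the successor of its cardinality. In a \<open>lam\<close>-directed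
  colimit the norm of an arrow is the supremum of the norms of its representatives, which
  increase along the diagram and take at most \<open>|K|\<close> values; so some representative attains it.
  Hence \<open>lam\<close>-directed colimits are computed on germs, a normed functor from a category with at most
  \<open>|K|\<close> arrows into such a colimit factors through a stage, and every small normed category is the
  \<open>lam\<close>-directed union of its subcategories with at most \<open>|K|\<close> arrows.
\<close>

section \<open>Small sets\<close>

text \<open>The norm is what forces a large cardinal. In a directed colimit the norm of an arrow is
  a supremum over stages, and \<open>v \<le> Sup A\<close> does not give \<open>v \<le> a\<close>
  for a single \<open>a\<close> in \<open>A\<close>; so, unlike a plain category, a finite normed
  category need not be finitely presentable. With \<open>lam\<close> above the number of values
  these suprema become maxima, and the usual argument for categories applies again. General colimits
  meet another obstacle: identifying objects makes new pairs of arrows composable, so a quotient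
  would also have to adjoin formal composites. A product of cocones already contains all composites,
  so neither words nor congruences are needed. Preservation is asked of an arbitrary colimit cocone,
  known only by its universal property. It has to be compared with the colimit made of germs before
  anything can be said about norm and equality of its arrows. Smallness of the quantale enters
  through \<open>K\<close>: it keeps \<open>lam\<close> below the universe and makes the set of
  generators small.\<close>

lemma small_card_leq: "|A| \<le>o |B| \<Longrightarrow> small U B \<Longrightarrow> small U A"
  unfolding small_def by (rule ordLeq_ordLess_trans)

lemma small_subset: "small U B \<Longrightarrow> A \<subseteq> B \<Longrightarrow> small U A"
  by (meson card_of_mono1 small_card_leq)

lemma small_image: "small U A \<Longrightarrow> small U (f ` A)"
  by (meson card_of_image small_card_leq)

lemma small_inj: "inj_on f A \<Longrightarrow> f ` A \<subseteq> B \<Longrightarrow> small U B \<Longrightarrow> small U A"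
  by (meson card_of_ordLeq small_card_leq)

lemma small_ex_inj:
  assumes "small TYPE('u) A" shows "\<exists>e :: _ \<Rightarrow> 'u. inj_on e A"
  using assms unfolding small_def by (metis card_of_ordLeq ordLess_imp_ordLeq)

lemma universe_infinite: "universe TYPE('u) \<Longrightarrow> infinite (UNIV :: 'u set)"
  unfolding universe_def
  by (meson finite_iff_ordLess_natLeq not_ordLess_ordLeq ordLess_imp_ordLeq)

lemma small_nat: "universe TYPE('u) \<Longrightarrow> small TYPE('u) (UNIV :: nat set)"
  unfolding universe_def small_def using card_of_nat ordIso_ordLess_trans by blast

text \<open>\<open>universe\<close> closes smallness under power sets only for subsets of
  \<open>'u\<close>; an injection into \<open>'u\<close> carries this to sets of any type.\<close>

lemma small_Pow:
  assumes "universe TYPE('u)" "small TYPE('u) A" shows "small TYPE('u) (Pow A)"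
proof -
  obtain e :: "_ \<Rightarrow> 'u" where e: "inj_on e A" using small_ex_inj assms(2) by blast
  have "small TYPE('u) (e ` A)" using assms(2) by (rule small_image)
  then have "small TYPE('u) (Pow (e ` A))" using assms(1) unfolding universe_def small_def by blast
  moreover have "inj_on ((`) e) (Pow A)" using e by (meson inj_on_image_Pow)
  ultimately show ?thesis by (metis image_Pow_surj small_inj subset_refl)
qed

text \<open>A regular infinite cardinal is stable: fewer than that many sets, each below it, have a
  disjoint union below it.\<close>

lemma small_Sigma:
  assumes U: "universe TYPE('u)" and "small TYPE('u) A" "\<And>a. a \<in> A \<Longrightarrow> small TYPE('u) (F a)"
  shows "small TYPE('u) (Sigma A F)"
proof -
  have "stable |UNIV :: 'u set|"
    using U universe_infinite[OF U] unfolding universe_def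
    by (intro regularCard_stable) (auto simp: Field_card_of card_of_card_order_on)
  then show ?thesis using assms(2,3) unfolding small_def by (rule stable_elim)
qed

lemma small_UNION:
  assumes "universe TYPE('u)" "small TYPE('u) A" "\<And>a. a \<in> A \<Longrightarrow> small TYPE('u) (F a)"
  shows "small TYPE('u) (\<Union>a\<in>A. F a)"
  using small_card_leq[OF card_of_UNION_Sigma small_Sigma] assms by blast

lemma small_Times:
  "universe TYPE('u) \<Longrightarrow> small TYPE('u) A \<Longrightarrow> small TYPE('u) B \<Longrightarrow> small TYPE('u) (A \<times> B)"
  by (rule small_Sigma)

lemma small_Plus:
  "universe TYPE('u) \<Longrightarrow> small TYPE('u) A \<Longrightarrow> small TYPE('u) B \<Longrightarrow> small TYPE('u) (A <+> B)"
  unfolding small_def by (rule card_of_Plus_ordLess_infinite[OF universe_infinite])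

text \<open>Extensional functions embed into a power set by their graphs over
  \<open>A\<close>.\<close>

lemma small_PiE:
  assumes U: "universe TYPE('u)" and "small TYPE('u) A" "small TYPE('u) B"
  shows "small TYPE('u) (A \<rightarrow>\<^sub>E B)"
proof (rule small_inj)
  show "small TYPE('u) (Pow (A \<times> B))" using assms by (intro small_Pow small_Times)
  show "(\<lambda>f. (\<lambda>x. (x, f x)) ` A) ` (A \<rightarrow>\<^sub>E B) \<subseteq> Pow (A \<times> B)" by auto
  show "inj_on (\<lambda>f. (\<lambda>x. (x, f x)) ` A) (A \<rightarrow>\<^sub>E B)"
  proof (rule inj_onI)
    fix f g assume f: "f \<in> A \<rightarrow>\<^sub>E B" and g: "g \<in> A \<rightarrow>\<^sub>E B"
      and eq: "(\<lambda>x. (x, f x)) ` A = (\<lambda>x. (x, g x)) ` A"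
    have "f x = g x" if "x \<in> A" for x
    proof -
      have "(x, f x) \<in> (\<lambda>x. (x, g x)) ` A" using that eq by blast
      then show ?thesis by auto
    qed
    then show "f = g" using f g by (intro PiE_ext)
  qed
qed

section \<open>Sets generated by a partial binary operation\<close>

text \<open>\<open>R a b\<close> says that \<open>m b a\<close> is defined; the order of the
  arguments is that of \<open>Comp\<close>. Both the families in a product of cocones and the
  subcategories used as generators arise in this way.\<close>

inductive_set op_closure :: "'a set \<Rightarrow> ('a \<Rightarrow> 'a \<Rightarrow> bool) \<Rightarrow> ('a \<Rightarrow> 'a \<Rightarrow> 'a) \<Rightarrow> 'a set"
  for G R m where
  gen: "a \<in> G \<Longrightarrow> a \<in> op_closure G R m"
| op: "a \<in> op_closure G R m \<Longrightarrow> b \<in> op_closure G R m \<Longrightarrow> R a b \<Longrightarrow> m b a \<in> op_closure G R m"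

text \<open>The closure lies in the union of countably many rounds \<open>S n\<close>, each adding
  \<open>m b a\<close> for all pairs, whether or not \<open>R\<close> holds. An infinite
  \<open>|K|\<close> absorbs both the squares and the countable union.\<close>

lemma card_of_op_closure:
  assumes inf: "infinite K" and G: "|G| \<le>o |K|"
  shows "|op_closure G R m| \<le>o |K|"
proof -
  define S where "S n = ((\<lambda>T. T \<union> (\<lambda>(a, b). m b a) ` (T \<times> T)) ^^ n) G" for n
  have card_S: "|S n| \<le>o |K|" for n
  proof (induction n)
    case 0 show ?case using G by (simp add: S_def)
  next
    case (Suc n)
    have "|S n \<times> S n| \<le>o |K|" using Suc inf by (simp add: card_of_Sigma_ordLeq_infinite)
    then have "|(\<lambda>(a, b). m b a) ` (S n \<times> S n)| \<le>o |K|"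
      using card_of_image ordLeq_transitive by blast
    then have "|S n \<union> (\<lambda>(a, b). m b a) ` (S n \<times> S n)| \<le>o |K|"
      using Suc inf by (intro card_of_Un_ordLeq_infinite_Field) (auto simp: Field_card_of card_of_card_order_on)
    then show ?case by (simp add: S_def)
  qed
  have mono: "S i \<subseteq> S j" if "i \<le> j" for i j
    using that by (rule lift_Suc_mono_le[rotated]) (auto simp: S_def)
  have "a \<in> (\<Union>n. S n)" if "a \<in> op_closure G R m" for a
    using that
  proof induction
    case (gen a) then have "a \<in> S 0" by (simp add: S_def) then show ?case by blast
  next
    case (op a b)
    then obtain i j where "a \<in> S i" "b \<in> S j" by blast
    then have "a \<in> S (max i j)" "b \<in> S (max i j)" using mono by (meson max.cobounded1 max.cobounded2 subsetD)+
    then have "m b a \<in> S (Suc (max i j))" by (auto simp: S_def)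
    then show ?case by blast
  qed
  then have "|op_closure G R m| \<le>o |\<Union>n. S n|" by (intro card_of_mono1) blast
  also have "|\<Union>n. S n| \<le>o |K|"
    using inf card_S infinite_iff_card_of_nat by (intro card_of_UNION_ordLeq_infinite) auto
  finally show ?thesis .
qed

text \<open>Since \<open>G\<close> may be finite, a copy of the natural numbers is added to obtain
  an infinite bound.\<close>

lemma small_op_closure:
  fixes G :: "'a set"
  assumes "universe TYPE('u)" "small TYPE('u) G"
  shows "small TYPE('u) (op_closure G R m)"
proof (rule small_card_leq)
  show "|op_closure G R m| \<le>o |G <+> (UNIV :: nat set)|"
    by (intro card_of_op_closure) (auto simp: card_of_Plus1)
  show "small TYPE('u) (G <+> (UNIV :: nat set))"
    using assms small_nat small_Plus by blast
qed

text \<open>The successor is at most \<open>|Pow K|\<close>, hence below the universe, which is a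
  strong limit. As \<open>lam\<close> has to be an order on \<open>'u\<close>, the successor is
  replaced by the cardinal order of an equipotent subset \<open>L\<close>.\<close>

lemma ex_small_cardSuc:
  assumes U: "universe TYPE('u)" and K: "small TYPE('u) K" "infinite K"
  shows "\<exists>lam :: 'u rel. Cinfinite lam \<and> regularCard lam \<and> lam <o |UNIV :: 'u set| \<and> lam =o cardSuc |K|"
proof -
  let ?c = "cardSuc |K|"
  have inf: "Cinfinite |K|" using K(2) by (simp add: cinfinite_def Field_card_of card_of_card_order_on)
  have c: "Cinfinite ?c" "regularCard ?c" using inf Cinfinite_cardSuc regularCard_cardSuc by blast+
  have "?c \<le>o |Pow K|"
    by (intro cardSuc_least) (auto simp: card_of_Card_order card_of_Pow)
  moreover have "|Pow K| <o |UNIV :: 'u set|" using small_Pow[OF U K(1)] by (simp add: small_def)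
  ultimately have less: "?c <o |UNIV :: 'u set|" using ordLeq_ordLess_trans by blast
  have fc: "|Field ?c| =o ?c" using c(1) card_of_Field_ordIso by blast
  then have "|Field ?c| \<le>o |UNIV :: 'u set|"
    by (rule ordIso_ordLeq_trans[OF _ ordLess_imp_ordLeq[OF less]])
  then obtain L :: "'u set" where "|Field ?c| =o |L|" using internalize_card_of_ordLeq2[THEN iffD1] by blast
  then have L: "|L| =o ?c" using fc ordIso_symmetric ordIso_transitive by blast
  have "Cinfinite |L|" using Cinfinite_cong[OF ordIso_symmetric[OF L]] c by blast
  moreover have "regularCard |L|" using regularCard_ordIso[OF ordIso_symmetric[OF L]] c by blast
  moreover have "|L| <o |UNIV :: 'u set|" using L less ordIso_ordLess_trans by blast
  ultimately show ?thesis using L by blast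
qed

text \<open>The benefit of a successor cardinal: directedness becomes a bound for families of size
  at most \<open>|K|\<close>.\<close>

lemma card_less_cardSuc_iff:
  assumes "lam =o cardSuc |K|" shows "|S| <o lam \<longleftrightarrow> |S| \<le>o |K|"
proof -
  have "|S| <o lam \<longleftrightarrow> |S| <o cardSuc |K|"
    using assms by (meson ordIso_symmetric ordLess_ordIso_trans)
  then show ?thesis by (simp add: cardSuc_ordLeq_ordLess card_of_Card_order)
qed

section \<open>Normed categories\<close>

context category begin

lemma Id_simps [simp]:
  assumes "x \<in> Obj C"
  shows "Id C x \<in> Arr C" "Dom C (Id C x) = x" "Cod C (Id C x) = x"
  using Id_in[OF assms] by (auto simp: hom_def)

lemma Comp_simps [simp]:
  assumes "f \<in> Arr C" "g \<in> Arr C" "Cod C f = Dom C g"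
  shows "Comp C g f \<in> Arr C" "Dom C (Comp C g f) = Dom C f" "Cod C (Comp C g f) = Cod C g"
  using Comp_in[of f "Dom C f" "Dom C g" g "Cod C g"] assms by (auto simp: hom_def)

lemma Comp_Id_Dom [simp]: "f \<in> Arr C \<Longrightarrow> Comp C f (Id C (Dom C f)) = f"
  using Comp_Id by (auto simp: hom_def)

lemma Id_Cod_Comp [simp]: "f \<in> Arr C \<Longrightarrow> Comp C (Id C (Cod C f)) f = f"
  using Id_Comp by (auto simp: hom_def)

lemma Comp_assoc_arr:
  "f \<in> Arr C \<Longrightarrow> g \<in> Arr C \<Longrightarrow> h \<in> Arr C \<Longrightarrow> Cod C f = Dom C g \<Longrightarrow> Cod C g = Dom C h \<Longrightarrow>
    Comp C h (Comp C g f) = Comp C (Comp C h g) f"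
  by (rule Comp_assoc) (auto simp: hom_def)

declare Dom_in [simp] Cod_in [simp]

end

lemma normed_categoryI:
  assumes "\<And>f. f \<in> Arr X \<Longrightarrow> Dom X f \<in> Obj X \<and> Cod X f \<in> Obj X"
    and "\<And>x. x \<in> Obj X \<Longrightarrow> Id X x \<in> Arr X \<and> Dom X (Id X x) = x \<and> Cod X (Id X x) = x \<and> 1 \<le> nrm X (Id X x)"
    and "\<And>f g. f \<in> Arr X \<Longrightarrow> g \<in> Arr X \<Longrightarrow> Cod X f = Dom X g \<Longrightarrow>
      Comp X g f \<in> Arr X \<and> Dom X (Comp X g f) = Dom X f \<and> Cod X (Comp X g f) = Cod X g \<and>
      nrm X f * nrm X g \<le> nrm X (Comp X g f)"
    and "\<And>f. f \<in> Arr X \<Longrightarrow> Comp X f (Id X (Dom X f)) = f \<and> Comp X (Id X (Cod X f)) f = f"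
    and "\<And>f g h. f \<in> Arr X \<Longrightarrow> g \<in> Arr X \<Longrightarrow> h \<in> Arr X \<Longrightarrow> Cod X f = Dom X g \<Longrightarrow>
      Cod X g = Dom X h \<Longrightarrow> Comp X h (Comp X g f) = Comp X (Comp X h g) f"
  shows "normed_category X"
  by unfold_locales (use assms in \<open>auto simp: hom_def\<close>)

lemma normed_category_nrm_Comp:
  "normed_category X \<Longrightarrow> f \<in> Arr X \<Longrightarrow> g \<in> Arr X \<Longrightarrow> Cod X f = Dom X g \<Longrightarrow>
    nrm X f * nrm X g \<le> nrm X (Comp X g f)"
  by (rule normed_category.nrm_Comp[of X f "Dom X f" "Dom X g"]) (auto simp: hom_def)

lemmas normed_category_category = normed_category.axioms(1)

section \<open>Functors as maps of arrows\<close>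

text \<open>The two conditions on identities do the work of an object map: sending the identity at
  an end of \<open>f\<close> to the identity at the corresponding end of \<open>a f\<close>
  expresses at once that identities are preserved and that ends match.\<close>

definition arrfun ::
  "('o, 'a, 'v::quantale, 'x) ncat_scheme \<Rightarrow> ('p, 'b, 'v, 'y) ncat_scheme \<Rightarrow> ('a \<Rightarrow> 'b) \<Rightarrow> bool" where
  "arrfun X Y a \<longleftrightarrow>
     (\<forall>f \<in> Arr X. a f \<in> Arr Y \<and> nrm X f \<le> nrm Y (a f) \<and>
        a (Id X (Dom X f)) = Id Y (Dom Y (a f)) \<and> a (Id X (Cod X f)) = Id Y (Cod Y (a f))) \<and>
     (\<forall>f \<in> Arr X. \<forall>g \<in> Arr X. Cod X f = Dom X g \<longrightarrow> a (Comp X g f) = Comp Y (a g) (a f))"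

lemma arrfunI:
  assumes "\<And>f. f \<in> Arr X \<Longrightarrow> a f \<in> Arr Y"
    and "\<And>f. f \<in> Arr X \<Longrightarrow> nrm X f \<le> nrm Y (a f)"
    and "\<And>f. f \<in> Arr X \<Longrightarrow> a (Id X (Dom X f)) = Id Y (Dom Y (a f))"
    and "\<And>f. f \<in> Arr X \<Longrightarrow> a (Id X (Cod X f)) = Id Y (Cod Y (a f))"
    and "\<And>f g. f \<in> Arr X \<Longrightarrow> g \<in> Arr X \<Longrightarrow> Cod X f = Dom X g \<Longrightarrow> a (Comp X g f) = Comp Y (a g) (a f)"
  shows "arrfun X Y a"
  using assms unfolding arrfun_def by blast

lemma arrfunD:
  assumes "arrfun X Y a" "f \<in> Arr X"
  shows "a f \<in> Arr Y" "nrm X f \<le> nrm Y (a f)"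
    "a (Id X (Dom X f)) = Id Y (Dom Y (a f))" "a (Id X (Cod X f)) = Id Y (Cod Y (a f))"
  using assms unfolding arrfun_def by blast+

lemma arrfun_Comp:
  assumes "arrfun X Y a" "f \<in> Arr X" "g \<in> Arr X" "Cod X f = Dom X g"
  shows "a (Comp X g f) = Comp Y (a g) (a f)"
  using assms unfolding arrfun_def by blast

lemma (in category) Id_eq_iff: "x \<in> Obj C \<Longrightarrow> y \<in> Obj C \<Longrightarrow> Id C x = Id C y \<longleftrightarrow> x = y"
  using Id_simps(2) by metis

text \<open>\<open>Id\<close> is injective on objects, and the identities at the two ends are both
  the image of the identity at the common object.\<close>

lemma arrfun_composable:
  assumes Y: "category Y" and a: "arrfun X Y a" and f: "f \<in> Arr X" "g \<in> Arr X" "Cod X f = Dom X g"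
  shows "Cod Y (a f) = Dom Y (a g)"
  using arrfunD[OF a f(1)] arrfunD[OF a f(2)] f(3) category.Id_eq_iff[OF Y]
  by (metis Y category.Cod_in category.Dom_in)

lemma arrfun_Id:
  assumes X: "category X" and a: "arrfun X Y a" and x: "x \<in> Obj X"
  shows "a (Id X x) = Id Y (Dom Y (a (Id X x)))"
  using arrfunD(3)[OF a, of "Id X x"] category.Id_simps[OF X x] by simp

lemma arrfun_compose:
  assumes X: "category X" and Y: "category Y" and a: "arrfun X Y a" and b: "arrfun Y Z b"
  shows "arrfun X Z (b \<circ> a)"
proof (rule arrfunI)
  fix f assume f: "f \<in> Arr X"
  note af = arrfunD[OF a f]
  note bf = arrfunD[OF b af(1)]
  show "(b \<circ> a) f \<in> Arr Z" "nrm X f \<le> nrm Z ((b \<circ> a) f)"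
    "(b \<circ> a) (Id X (Dom X f)) = Id Z (Dom Z ((b \<circ> a) f))"
    "(b \<circ> a) (Id X (Cod X f)) = Id Z (Cod Z ((b \<circ> a) f))"
    using af bf by auto
  fix g assume g: "g \<in> Arr X" "Cod X f = Dom X g"
  show "(b \<circ> a) (Comp X g f) = Comp Z ((b \<circ> a) g) ((b \<circ> a) f)"
    using arrfun_Comp[OF a f g] arrfun_composable[OF Y a f g] arrfun_Comp[OF b af(1) arrfunD(1)[OF a g(1)]]
    by simp
qed

text \<open>The value at an object is read off from the image of its identity. The restrictions make
  the result extensional, as arrows of \<open>Cat_normed\<close> have to be.\<close>

definition functor_of ::
  "('o, 'a, 'v::quantale, 'x) ncat_scheme \<Rightarrow> ('a \<Rightarrow> 'b) \<Rightarrow> ('p, 'b, 'v, 'y) ncat_scheme \<Rightarrow>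
    ('o, 'a, 'p, 'b) functor_map" where
  "functor_of X a Y =
     \<lparr>ObjMap = (\<lambda>x\<in>Obj X. Dom Y (a (Id X x))), ArrMap = (\<lambda>f\<in>Arr X. a f)\<rparr>"

lemma normed_functor_of:
  assumes X: "normed_category X" and Y: "normed_category Y" and a: "arrfun X Y a"
  shows "normed_functor X Y (functor_of X a Y)"
proof -
  interpret X: normed_category X by fact
  interpret Y: normed_category Y by fact
  have ob: "Dom Y (a (Id X x)) \<in> Obj Y" if "x \<in> Obj X" for x
    using arrfunD(1)[OF a] that by auto
  have dom: "Dom Y (a (Id X (Dom X f))) = Dom Y (a f)" "Dom Y (a (Id X (Cod X f))) = Cod Y (a f)"
    if "f \<in> Arr X" for f
    using arrfunD[OF a that] by simp_all
  show ?thesis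
  proof unfold_locales
    fix f x y assume f: "f \<in> hom X x y"
    then show "ArrMap (functor_of X a Y) f \<in>
        hom Y (ObjMap (functor_of X a Y) x) (ObjMap (functor_of X a Y) y)"
      using arrfunD(1)[OF a] dom by (auto simp: hom_def functor_of_def)
    fix g z assume g: "g \<in> hom X y z"
    show "ArrMap (functor_of X a Y) (Comp X g f) =
        Comp Y (ArrMap (functor_of X a Y) g) (ArrMap (functor_of X a Y) f)"
      using f g arrfun_Comp[OF a] by (auto simp: hom_def functor_of_def)
  qed (use a ob arrfunD[OF a] arrfun_Id[OF X.category_axioms a] in \<open>auto simp: functor_of_def\<close>)
qed

lemma arrfun_ArrMap:
  assumes "normed_functor X Y F" shows "arrfun X Y (ArrMap F)"
proof -
  interpret normed_functor X Y F by fact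
  have h: "ArrMap F f \<in> hom Y (ObjMap F (Dom X f)) (ObjMap F (Cod X f))" if "f \<in> Arr X" for f
    using ArrMap_in[of f] that by (auto simp: hom_def)
  show ?thesis
  proof (rule arrfunI)
    fix f g assume f: "f \<in> Arr X" and g: "g \<in> Arr X" "Cod X f = Dom X g"
    show "ArrMap F (Comp X g f) = Comp Y (ArrMap F g) (ArrMap F f)"
      using f g ArrMap_Comp[of f "Dom X f" "Cod X f" g "Cod X g"] by (auto simp: hom_def)
  qed (use h ArrMap_Id nrm_ArrMap in \<open>auto simp: hom_def\<close>)
qed

text \<open>The object part is forced by \<open>ArrMap_Id\<close>, and the values outside
  \<open>X\<close> by extensionality.\<close>

lemma functor_of_ArrMap:
  assumes F: "normed_functor X Y F" and ext: "extensional_functor_map X F"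
  shows "F = functor_of X (ArrMap F) Y"
proof -
  interpret normed_functor X Y F by fact
  have "ObjMap F = (\<lambda>x\<in>Obj X. Dom Y (ArrMap F (Id X x)))"
    by (rule extensionalityI[of _ "Obj X"])
      (use ext ArrMap_Id ObjMap_in in \<open>auto simp: extensional_functor_map_def\<close>)
  moreover have "ArrMap F = (\<lambda>f\<in>Arr X. ArrMap F f)"
    using ext by (auto simp: extensional_functor_map_def extensional_restrict)
  ultimately show ?thesis unfolding functor_of_def by (cases F) simp
qed

section \<open>Arrows of \<open>Cat_normed\<close> handled through their arrow maps\<close>

definition arrow_of where "arrow_of X a Y = (X, functor_of X a Y, Y)"

definition arrmap where "arrmap u = ArrMap (fst (snd u))"

lemma arrmap_arrow_of: "f \<in> Arr X \<Longrightarrow> arrmap (arrow_of X a Y) f = a f"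
  by (simp add: arrmap_def arrow_of_def functor_of_def)

lemma arrow_of_cong:
  assumes "category X" "\<And>f. f \<in> Arr X \<Longrightarrow> a f = b f"
  shows "arrow_of X a Y = arrow_of X b Y"
  unfolding arrow_of_def functor_of_def
  using assms category.Id_simps(1)[OF assms(1)] by (auto intro!: restrict_ext)

lemma small_ncatsD:
  assumes "(X :: ('u, 'u, 'v::quantale) ncat) \<in> small_ncats"
  shows "normed_category X" "category X" "small TYPE('u) (Obj X)" "small TYPE('u) (Arr X)"
    "extensional_ncat X"
  using assms normed_category.axioms(1) unfolding small_ncats_def by blast+

lemma hom_Cat_normedI:
  "X \<in> small_ncats \<Longrightarrow> Y \<in> small_ncats \<Longrightarrow> arrfun X Y a \<Longrightarrow> arrow_of X a Y \<in> hom Cat_normed X Y"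
  using normed_functor_of[of X Y a] small_ncatsD(1)
  unfolding hom_def Cat_normed_def arrow_of_def
  by (auto simp: extensional_functor_map_def functor_of_def)

lemma hom_Cat_normedD:
  assumes "u \<in> hom Cat_normed X Y"
  shows "X \<in> small_ncats" "Y \<in> small_ncats" "arrfun X Y (arrmap u)" "u = arrow_of X (arrmap u) Y"
  using assms arrfun_ArrMap functor_of_ArrMap
  unfolding hom_def Cat_normed_def arrow_of_def arrmap_def by force+

lemma Obj_Cat_normed [simp]: "Obj Cat_normed = small_ncats"
  by (simp add: Cat_normed_def)

text \<open>Reduces equality of functors to arrows, where all uniqueness arguments below take
  place.\<close>

lemma Cat_normed_eqI:
  assumes "u \<in> hom Cat_normed X Y" "v \<in> hom Cat_normed X Y"
    and "\<And>f. f \<in> Arr X \<Longrightarrow> arrmap u f = arrmap v f"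
  shows "u = v"
proof -
  have "u = arrow_of X (arrmap u) Y" by (rule hom_Cat_normedD(4)[OF assms(1)])
  also have "\<dots> = arrow_of X (arrmap v) Y"
    by (rule arrow_of_cong[OF small_ncatsD(2)[OF hom_Cat_normedD(1)[OF assms(1)]] assms(3)])
  also have "\<dots> = v" by (rule hom_Cat_normedD(4)[OF assms(2), symmetric])
  finally show ?thesis .
qed

lemma Comp_arrow_of:
  assumes X: "category X" and Y: "category Y" and a: "arrfun X Y a"
  shows "Comp Cat_normed (arrow_of Y b Z) (arrow_of X a Y) = arrow_of X (b \<circ> a) Z"
proof -
  \<comment> \<open>On objects, the composite evaluates \<open>b\<close> at the identity of the
    domain of \<open>a (Id X x)\<close>; that identity is \<open>a (Id X x)\<close> itself.\<close>
  have 1: "Dom Y (a (Id X x)) \<in> Obj Y" "Id Y (Dom Y (a (Id X x))) = a (Id X x)" if "x \<in> Obj X" for x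
    using arrfunD(1)[OF a, of "Id X x"] arrfun_Id[OF X a that] category.Id_simps(1)[OF X that]
      category.Dom_in[OF Y] by auto
  show ?thesis
    unfolding Cat_normed_def arrow_of_def functor_of_def
    using 1 arrfunD(1)[OF a] by (auto simp: compose_def intro!: restrict_ext)
qed

lemma Id_Cat_normed:
  assumes "category X" shows "Id Cat_normed X = arrow_of X (\<lambda>f. f) X"
  using category.Id_simps[OF assms]
  by (auto simp: Cat_normed_def arrow_of_def functor_of_def intro!: restrict_ext)

lemma arrfun_id: "category X \<Longrightarrow> arrfun X X (\<lambda>f. f)"
  by (rule arrfunI) auto

lemma Comp_Cat_normed:
  assumes u: "u \<in> hom Cat_normed X Y" and v: "v \<in> hom Cat_normed Y Z"
  shows "Comp Cat_normed v u = arrow_of X (arrmap v \<circ> arrmap u) Z"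
    "Comp Cat_normed v u \<in> hom Cat_normed X Z"
    "f \<in> Arr X \<Longrightarrow> arrmap (Comp Cat_normed v u) f = arrmap v (arrmap u f)"
proof -
  note u = hom_Cat_normedD[OF u] and v = hom_Cat_normedD[OF v]
  note c = small_ncatsD(2)
  show 1: "Comp Cat_normed v u = arrow_of X (arrmap v \<circ> arrmap u) Z"
    by (subst u(4), subst v(4)) (rule Comp_arrow_of[OF c[OF u(1)] c[OF u(2)] u(3)])
  show "Comp Cat_normed v u \<in> hom Cat_normed X Z"
    unfolding 1 using u v c arrfun_compose by (blast intro: hom_Cat_normedI)
  show "f \<in> Arr X \<Longrightarrow> arrmap (Comp Cat_normed v u) f = arrmap v (arrmap u f)"
    unfolding 1 by (simp add: arrmap_arrow_of)
qed

lemma Id_Cat_normed_hom: "X \<in> small_ncats \<Longrightarrow> Id Cat_normed X \<in> hom Cat_normed X X"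
  by (simp add: Id_Cat_normed small_ncatsD(2) arrfun_id hom_Cat_normedI)

lemma arrmap_Id: "X \<in> small_ncats \<Longrightarrow> f \<in> Arr X \<Longrightarrow> arrmap (Id Cat_normed X) f = f"
  by (simp add: Id_Cat_normed small_ncatsD(2) arrmap_arrow_of)

lemma category_Cat_normed: "category (Cat_normed :: (('u, 'u, 'v::quantale) ncat, _) cat)"
proof
  fix u :: "('u, 'u, 'v) ncat \<times> ('u, 'u, 'u, 'u) functor_map \<times> ('u, 'u, 'v) ncat"
  fix X Y Z W :: "('u, 'u, 'v) ncat"
  show "u \<in> Arr Cat_normed \<Longrightarrow> Dom Cat_normed u \<in> Obj Cat_normed"
    "u \<in> Arr Cat_normed \<Longrightarrow> Cod Cat_normed u \<in> Obj Cat_normed"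
    by (auto simp: Cat_normed_def)
  show "X \<in> Obj Cat_normed \<Longrightarrow> Id Cat_normed X \<in> hom Cat_normed X X"
    by (simp add: Id_Cat_normed_hom)
  assume u: "u \<in> hom Cat_normed X Y"
  note X = hom_Cat_normedD(1)[OF u] and Y = hom_Cat_normedD(2)[OF u]
  show "Comp Cat_normed u (Id Cat_normed X) = u"
    by (rule Cat_normed_eqI[OF Comp_Cat_normed(2)[OF Id_Cat_normed_hom[OF X] u] u])
      (simp add: Comp_Cat_normed(3)[OF Id_Cat_normed_hom[OF X] u] arrmap_Id[OF X])
  show "Comp Cat_normed (Id Cat_normed Y) u = u"
    by (rule Cat_normed_eqI[OF Comp_Cat_normed(2)[OF u Id_Cat_normed_hom[OF Y]] u])
      (simp add: Comp_Cat_normed(3)[OF u Id_Cat_normed_hom[OF Y]] arrmap_Id[OF Y]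
        arrfunD(1)[OF hom_Cat_normedD(3)[OF u]])
  fix v w assume v: "v \<in> hom Cat_normed Y Z"
  show "Comp Cat_normed v u \<in> hom Cat_normed X Z" by (rule Comp_Cat_normed(2)[OF u v])
  assume w: "w \<in> hom Cat_normed Z W"
  note vu = Comp_Cat_normed(2)[OF u v] and wv = Comp_Cat_normed(2)[OF v w]
  show "Comp Cat_normed w (Comp Cat_normed v u) = Comp Cat_normed (Comp Cat_normed w v) u"
    by (rule Cat_normed_eqI[OF Comp_Cat_normed(2)[OF vu w] Comp_Cat_normed(2)[OF u wv]])
      (simp add: Comp_Cat_normed(3)[OF vu w] Comp_Cat_normed(3)[OF u wv] Comp_Cat_normed(3)[OF u v]
        Comp_Cat_normed(3)[OF v w] arrfunD(1)[OF hom_Cat_normedD(3)[OF u]])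
qed

text \<open>A functor is determined by its arrow map, a function between two small sets.\<close>

lemma locally_small_Cat_normed:
  assumes U: "universe TYPE('u)"
  shows "locally_small TYPE('u) (Cat_normed :: (('u, 'u, 'v::quantale) ncat, _) cat)"
  unfolding locally_small_def
proof (intro ballI)
  fix X Y :: "('u, 'u, 'v) ncat" assume "X \<in> Obj Cat_normed" "Y \<in> Obj Cat_normed"
  then have XY: "X \<in> small_ncats" "Y \<in> small_ncats" by auto
  show "small TYPE('u) (hom Cat_normed X Y)"
  proof (rule small_inj)
    show "small TYPE('u) (Arr X \<rightarrow>\<^sub>E Arr Y)" using U small_ncatsD(4) XY by (blast intro: small_PiE)
    show "(\<lambda>u. restrict (arrmap u) (Arr X)) ` hom Cat_normed X Y \<subseteq> Arr X \<rightarrow>\<^sub>E Arr Y"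
      using hom_Cat_normedD(3) arrfunD(1) by (fastforce simp: restrict_PiE_iff)
    show "inj_on (\<lambda>u. restrict (arrmap u) (Arr X)) (hom Cat_normed X Y)"
      by (rule inj_onI, rule Cat_normed_eqI, assumption+) (metis restrict_apply')
  qed
qed

section \<open>Transport of structure\<close>

text \<open>Objects are replaced by their identities, so an injection on the arrows suffices.\<close>

definition transport ::
  "('o, 'a, 'v::quantale) ncat \<Rightarrow> ('a \<Rightarrow> 'b) \<Rightarrow> ('b, 'b, 'v) ncat" where
  "transport X e = (let e' = inv_into (Arr X) e in
     \<lparr>Obj = e ` Id X ` Obj X,
      Arr = e ` Arr X,
      Dom = (\<lambda>f \<in> e ` Arr X. e (Id X (Dom X (e' f)))),
      Cod = (\<lambda>f \<in> e ` Arr X. e (Id X (Cod X (e' f)))),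
      Id = (\<lambda>x \<in> e ` Id X ` Obj X. x),
      Comp = (\<lambda>g f. if f \<in> e ` Arr X \<and> g \<in> e ` Arr X \<and> Cod X (e' f) = Dom X (e' g)
                    then e (Comp X (e' g) (e' f)) else undefined),
      nrm = (\<lambda>f \<in> e ` Arr X. nrm X (e' f))\<rparr>)"

context
  fixes X :: "('o, 'a, 'v::quantale) ncat" and e :: "'a \<Rightarrow> 'b"
  assumes X: "normed_category X" and e: "inj_on e (Arr X)"
begin

interpretation X: normed_category X by (rule X)

lemma inv_transport [simp]: "f \<in> Arr X \<Longrightarrow> inv_into (Arr X) e (e f) = f"
  using e by simp

lemma transport_simps [simp]:
  "Obj (transport X e) = e ` Id X ` Obj X"
  "Arr (transport X e) = e ` Arr X"
  "f \<in> Arr X \<Longrightarrow> Dom (transport X e) (e f) = e (Id X (Dom X f))"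
  "f \<in> Arr X \<Longrightarrow> Cod (transport X e) (e f) = e (Id X (Cod X f))"
  "x \<in> Obj X \<Longrightarrow> Id (transport X e) (e (Id X x)) = e (Id X x)"
  "f \<in> Arr X \<Longrightarrow> g \<in> Arr X \<Longrightarrow> Cod X f = Dom X g \<Longrightarrow>
     Comp (transport X e) (e g) (e f) = e (Comp X g f)"
  "f \<in> Arr X \<Longrightarrow> nrm (transport X e) (e f) = nrm X f"
  by (auto simp: transport_def Let_def)

lemma transport_composable:
  assumes "f \<in> Arr X" "g \<in> Arr X"
  shows "e (Id X (Cod X f)) = e (Id X (Dom X g)) \<longleftrightarrow> Cod X f = Dom X g"
  using inj_on_eq_iff[OF e, of "Id X (Cod X f)" "Id X (Dom X g)"] assms by (simp add: X.Id_eq_iff)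

lemma normed_category_transport: "normed_category (transport X e)"
  by (rule normed_categoryI)
    (auto simp: transport_composable X.nrm_Id normed_category_nrm_Comp[OF X] X.Comp_assoc_arr)

lemma extensional_transport: "extensional_ncat (transport X e)"
proof -
  have "\<not> (f \<in> Arr (transport X e) \<and> g \<in> Arr (transport X e) \<and> Cod (transport X e) f = Dom (transport X e) g)
      \<Longrightarrow> Comp (transport X e) g f = undefined" for f g
    using transport_composable by (auto simp: transport_def Let_def)
  then show ?thesis unfolding extensional_ncat_def by (auto simp: transport_def Let_def)
qed

lemma arrfun_transport: "arrfun X (transport X e) e"
  by (rule arrfunI) auto

lemma arrfun_inv_transport: "arrfun (transport X e) X (inv_into (Arr X) e)"
  by (rule arrfunI) (auto simp: transport_composable)

end

text \<open>Objects are coded as identities, so there are no more of them than arrows.\<close>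

lemma transport_small_ncats:
  fixes e :: "'a \<Rightarrow> 'u"
  assumes X: "normed_category X" and e: "inj_on e (Arr X)" and small: "small TYPE('u) (Arr X)"
  shows "transport X e \<in> small_ncats"
proof -
  have "Id X ` Obj X \<subseteq> Arr X"
    using category.Id_simps(1)[OF normed_category_category[OF X]] by blast
  then have "small TYPE('u) (e ` Id X ` Obj X)" using small small_subset small_image by metis
  then show ?thesis
    unfolding small_ncats_def
    using X e small small_image normed_category_transport extensional_transport transport_simps(1,2)
    by (metis (mono_tags, lifting) mem_Collect_eq)
qed

section \<open>Cocompleteness\<close>

text \<open>Preservation of the join of \<open>{x, y}\<close> gives monotonicity, since this join is
  \<open>y\<close> when \<open>x \<le> y\<close>; commutativity handles the other factor.\<close>

lemma quantale_mult_mono: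
  fixes a b c d :: "'v::quantale" assumes "a \<le> b" "c \<le> d" shows "a * c \<le> b * d"
proof -
  have 1: "x * z \<le> y * z" if "x \<le> y" for x y z :: 'v
  proof -
    have "y * z = Sup {x, y} * z" using that by (simp add: sup_absorb2)
    also have "\<dots> = sup (x * z) (y * z)" by (subst Sup_mult) simp
    finally show ?thesis by (metis sup.cobounded1)
  qed
  show ?thesis using 1[OF assms(1), of c] 1[OF assms(2), of b] by (simp add: mult.commute order_trans)
qed

lemma is_cocone_Cat_normedD:
  assumes "is_cocone J Cat_normed D c t"
  shows "c \<in> small_ncats" "i \<in> Obj J \<Longrightarrow> t i \<in> hom Cat_normed (ObjMap D i) c"
    "u \<in> Arr J \<Longrightarrow> Comp Cat_normed (t (Cod J u)) (ArrMap D u) = t (Dom J u)"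
  using assms unfolding is_cocone_def by auto

section \<open>Small colimits inside the product of all cocones\<close>

locale diagram =
  fixes J :: "('i, 'j, 'x) cat_scheme"
    and D :: "('i, 'j, ('u, 'u, 'v::quantale) ncat,
      ('u, 'u, 'v) ncat \<times> ('u, 'u, 'u, 'u) functor_map \<times> ('u, 'u, 'v) ncat) functor_map"
  assumes D: "is_functor J Cat_normed D"
begin

lemma D_obj: "i \<in> Obj J \<Longrightarrow> ObjMap D i \<in> small_ncats"
  using is_functor.ObjMap_in[OF D] by simp

lemma D_arr: "u \<in> Arr J \<Longrightarrow> ArrMap D u \<in> hom Cat_normed (ObjMap D (Dom J u)) (ObjMap D (Cod J u))"
  by (rule is_functor.ArrMap_in[OF D]) (simp add: hom_def)

lemma J_obj: "u \<in> Arr J \<Longrightarrow> Dom J u \<in> Obj J" "u \<in> Arr J \<Longrightarrow> Cod J u \<in> Obj J"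
  using D unfolding is_functor_def by (auto dest: category.Dom_in category.Cod_in)

text \<open>
  The colimit is generated inside the product of all cocones: its arrows are families indexed by
  the cocones, and no solution set is needed because all cocones live in one HOL type.
\<close>

definition cocones where "cocones = {(c, t). is_cocone J Cat_normed D c t}"

text \<open>The coprojection at stage \<open>i\<close>: its coordinate at a cocone is given by the
  leg of that cocone. It need not be injective.\<close>

definition inclusion where
  "inclusion i f = (\<lambda>q\<in>cocones. arrmap (snd q i) f)"

definition comp_fam where "comp_fam p' p = (\<lambda>q\<in>cocones. Comp (fst q) (p' q) (p q))"

text \<open>Closing under composition yields a subcategory: the generators include the identities at
  their own ends, and a composite has the ends of its factors
  (\<open>dom_cod_fam_in\<close>).\<close>

definition families where
  "families = op_closure (\<Union>i\<in>Obj J. inclusion i ` Arr (ObjMap D i))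
     (\<lambda>p p'. \<forall>q\<in>cocones. Cod (fst q) (p q) = Dom (fst q) (p' q))
     comp_fam"

text \<open>An object of the generated category is represented by its family of identities, which is
  why these return families of arrows.\<close>

definition dom_fam where "dom_fam p = (\<lambda>q\<in>cocones. Id (fst q) (Dom (fst q) (p q)))"
definition cod_fam where "cod_fam p = (\<lambda>q\<in>cocones. Id (fst q) (Cod (fst q) (p q)))"

text \<open>The infimum is the product norm, the largest one for which every evaluation at a cocone
  is a normed functor.\<close>

definition fam_cat where
  "fam_cat = \<lparr>Obj = dom_fam ` families, Arr = families, Dom = dom_fam, Cod = cod_fam, Id = (\<lambda>x. x),
     Comp = comp_fam,
     nrm = (\<lambda>p. INF q\<in>cocones. nrm (fst q) (p q))\<rparr>"

lemma cocones_ncat: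
  assumes "q \<in> cocones"
  shows "normed_category (fst q)" "category (fst q)" "fst q \<in> small_ncats"
  using assms is_cocone_Cat_normedD(1) small_ncatsD(1,2) unfolding cocones_def by fastforce+

lemma cocones_arrfun:
  assumes "q \<in> cocones" "i \<in> Obj J"
  shows "snd q i \<in> hom Cat_normed (ObjMap D i) (fst q)" "arrfun (ObjMap D i) (fst q) (arrmap (snd q i))"
proof -
  show *: "snd q i \<in> hom Cat_normed (ObjMap D i) (fst q)"
    using assms is_cocone_Cat_normedD(2) unfolding cocones_def by fastforce
  show "arrfun (ObjMap D i) (fst q) (arrmap (snd q i))" by (rule hom_Cat_normedD(3)[OF *])
qed

lemma inclusion_in: "i \<in> Obj J \<Longrightarrow> f \<in> Arr (ObjMap D i) \<Longrightarrow> inclusion i f \<in> families"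
  unfolding families_def by (rule op_closure.gen) blast

lemma families_arr: "p \<in> families \<Longrightarrow> q \<in> cocones \<Longrightarrow> p q \<in> Arr (fst q)"
  unfolding families_def
proof (induction rule: op_closure.induct)
  case (gen a)
  then show ?case using arrfunD(1)[OF cocones_arrfun(2)] by (auto simp: inclusion_def)
next
  case (op a b)
  then show ?case using category.Comp_simps(1)[OF cocones_ncat(2)] by (auto simp: comp_fam_def)
qed

lemma families_ext: "p \<in> families \<Longrightarrow> p \<in> extensional cocones"
  unfolding families_def by (induction rule: op_closure.induct) (auto simp: inclusion_def extensional_def comp_fam_def)

lemma inclusion_Id:
  assumes "i \<in> Obj J" "f \<in> Arr (ObjMap D i)"
  shows "dom_fam (inclusion i f) = inclusion i (Id (ObjMap D i) (Dom (ObjMap D i) f))"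
    "cod_fam (inclusion i f) = inclusion i (Id (ObjMap D i) (Cod (ObjMap D i) f))"
  using arrfunD(3,4)[OF cocones_arrfun(2)[OF _ assms(1)] assms(2)]
  by (auto simp: dom_fam_def cod_fam_def inclusion_def intro!: restrict_ext)

lemma dom_cod_fam_in: "p \<in> families \<Longrightarrow> dom_fam p \<in> families \<and> cod_fam p \<in> families"
proof (subst (asm) families_def, induction rule: op_closure.induct)
  case (gen a)
  then obtain i f where i: "i \<in> Obj J" and f: "f \<in> Arr (ObjMap D i)" and a: "a = inclusion i f"
    by blast
  have "category (ObjMap D i)" using D_obj i small_ncatsD(2) by blast
  then show ?case
    unfolding a inclusion_Id[OF i f]
    by (intro conjI inclusion_in i) (simp_all add: category.Id_simps category.Dom_in category.Cod_in f)
next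
  case (op a b)
  have ab: "a \<in> families" "b \<in> families" using op.hyps(1,2) unfolding families_def by -
  have "dom_fam (comp_fam b a) = dom_fam a" "cod_fam (comp_fam b a) = cod_fam b"
    using category.Comp_simps(2,3)[OF cocones_ncat(2) families_arr[OF ab(1)] families_arr[OF ab(2)]] op.hyps(3)
    by (auto simp: dom_fam_def cod_fam_def comp_fam_def intro!: restrict_ext)
  then show ?case using op.IH by simp
qed

lemma fam_Id:
  assumes "p \<in> families" "q \<in> cocones"
  shows "Dom (fst q) (Id (fst q) (Dom (fst q) (p q))) = Dom (fst q) (p q)"
    "Cod (fst q) (Id (fst q) (Dom (fst q) (p q))) = Dom (fst q) (p q)"
    "Dom (fst q) (Id (fst q) (Cod (fst q) (p q))) = Cod (fst q) (p q)"
    "Cod (fst q) (Id (fst q) (Cod (fst q) (p q))) = Cod (fst q) (p q)"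
proof -
  interpret category "fst q" by (rule cocones_ncat(2)[OF assms(2)])
  show "Dom (fst q) (Id (fst q) (Dom (fst q) (p q))) = Dom (fst q) (p q)"
    "Cod (fst q) (Id (fst q) (Dom (fst q) (p q))) = Dom (fst q) (p q)"
    "Dom (fst q) (Id (fst q) (Cod (fst q) (p q))) = Cod (fst q) (p q)"
    "Cod (fst q) (Id (fst q) (Cod (fst q) (p q))) = Cod (fst q) (p q)"
    using families_arr[OF assms] by simp_all
qed

text \<open>Equal families of identities have equal coordinates, and \<open>Id\<close> is injective
  on the objects of each cocone vertex.\<close>

lemma fam_composable:
  assumes "p \<in> families" "p' \<in> families" "cod_fam p = dom_fam p'" "q \<in> cocones"
  shows "Cod (fst q) (p q) = Dom (fst q) (p' q)"
proof -
  have "Id (fst q) (Cod (fst q) (p q)) = Id (fst q) (Dom (fst q) (p' q))"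
    using fun_cong[OF assms(3), of q] assms(4) by (simp add: dom_fam_def cod_fam_def)
  then show ?thesis
    using category.Id_eq_iff[OF cocones_ncat(2)[OF assms(4)]] families_arr assms
      category.Cod_in[OF cocones_ncat(2)] category.Dom_in[OF cocones_ncat(2)] by meson
qed

lemma comp_fam_in:
  assumes "p \<in> families" "p' \<in> families" "cod_fam p = dom_fam p'"
  shows "comp_fam p' p \<in> families"
  using op_closure.op[OF assms(1,2)[unfolded families_def]] fam_composable[OF assms]
  unfolding families_def by blast

text \<open>Every law holds coordinatewise. For the norm, monotonicity of the tensor bounds the
  product of the two infima by the product of the norms at each coordinate.\<close>

lemma normed_category_fam_cat: "normed_category fam_cat"
proof (rule normed_categoryI)
  have arr: "p q \<in> Arr (fst q)" "category (fst q)" if "p \<in> families" "q \<in> cocones" for p q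
    using families_arr cocones_ncat that by auto
  have idem: "dom_fam (dom_fam p) = dom_fam p" "cod_fam (dom_fam p) = dom_fam p"
      "dom_fam (cod_fam p) = cod_fam p"
    if "p \<in> families" for p
    by (simp_all add: dom_fam_def cod_fam_def fam_Id[OF that] cong: restrict_cong)
  fix p assume p': "p \<in> Arr fam_cat"
  then have p: "p \<in> families" by (simp add: fam_cat_def)
  show "Dom fam_cat p \<in> Obj fam_cat \<and> Cod fam_cat p \<in> Obj fam_cat"
    using p idem(3)[OF p] dom_cod_fam_in[OF p] by (simp add: fam_cat_def) (metis imageI)
  have "comp_fam p (dom_fam p) q = p q" "comp_fam (cod_fam p) p q = p q" for q
    using extensional_arb[OF families_ext[OF p], of q] arr[OF p, of q]
    by (auto simp: dom_fam_def cod_fam_def comp_fam_def restrict_def category.Comp_Id_Dom category.Id_Cod_Comp)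
  then show "Comp fam_cat p (Id fam_cat (Dom fam_cat p)) = p \<and> Comp fam_cat (Id fam_cat (Cod fam_cat p)) p = p"
    by (auto simp: fam_cat_def)
  fix p' assume "p' \<in> Arr fam_cat" "Cod fam_cat p = Dom fam_cat p'"
  then have p': "p' \<in> families" "cod_fam p = dom_fam p'" by (auto simp: fam_cat_def)
  note c = fam_composable[OF p p']
  show "Comp fam_cat p' p \<in> Arr fam_cat \<and> Dom fam_cat (Comp fam_cat p' p) = Dom fam_cat p \<and>
      Cod fam_cat (Comp fam_cat p' p) = Cod fam_cat p' \<and>
      nrm fam_cat p * nrm fam_cat p' \<le> nrm fam_cat (Comp fam_cat p' p)"
  proof (intro conjI)
    show "Comp fam_cat p' p \<in> Arr fam_cat" using comp_fam_in[OF p p'] by (simp add: fam_cat_def)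
    show "Dom fam_cat (Comp fam_cat p' p) = Dom fam_cat p" "Cod fam_cat (Comp fam_cat p' p) = Cod fam_cat p'"
      using category.Comp_simps(2,3)[OF arr(2)[OF p] arr(1)[OF p] arr(1)[OF p'(1)] c]
      by (auto simp: fam_cat_def dom_fam_def cod_fam_def comp_fam_def intro!: restrict_ext)
    have "(INF q\<in>cocones. nrm (fst q) (p q)) * (INF q\<in>cocones. nrm (fst q) (p' q))
        \<le> nrm (fst q) (Comp (fst q) (p' q) (p q))" if q: "q \<in> cocones" for q
    proof (rule order_trans)
      show "(INF q\<in>cocones. nrm (fst q) (p q)) * (INF q\<in>cocones. nrm (fst q) (p' q))
          \<le> nrm (fst q) (p q) * nrm (fst q) (p' q)"
        by (intro quantale_mult_mono INF_lower q)
      show "\<dots> \<le> nrm (fst q) (Comp (fst q) (p' q) (p q))"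
        by (rule normed_category_nrm_Comp[OF cocones_ncat(1)[OF q] arr(1)[OF p q] arr(1)[OF p'(1) q] c[OF q]])
    qed
    then show "nrm fam_cat p * nrm fam_cat p' \<le> nrm fam_cat (Comp fam_cat p' p)"
      by (auto simp: fam_cat_def comp_fam_def intro!: INF_greatest)
  qed
  fix p'' assume "p'' \<in> Arr fam_cat" "Cod fam_cat p' = Dom fam_cat p''"
  then have p'': "p'' \<in> families" "cod_fam p' = dom_fam p''" by (auto simp: fam_cat_def)
  show "Comp fam_cat p'' (Comp fam_cat p' p) = Comp fam_cat (Comp fam_cat p'' p') p"
    using category.Comp_assoc_arr[OF arr(2)[OF p] arr(1)[OF p] arr(1)[OF p'(1)] arr(1)[OF p''(1)] c
        fam_composable[OF p'(1) p'']]
    by (auto simp: fam_cat_def comp_fam_def intro!: restrict_ext)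
next
  fix x assume "x \<in> Obj fam_cat"
  then obtain p where p: "p \<in> families" and x: "x = dom_fam p" by (auto simp: fam_cat_def)
  have q: "category (fst q)" "Dom (fst q) (p q) \<in> Obj (fst q)" if "q \<in> cocones" for q
    using cocones_ncat[OF that] families_arr[OF p that] category.Dom_in by auto
  show "Id fam_cat x \<in> Arr fam_cat \<and> Dom fam_cat (Id fam_cat x) = x \<and> Cod fam_cat (Id fam_cat x) = x \<and>
      1 \<le> nrm fam_cat (Id fam_cat x)"
    using dom_cod_fam_in[OF p] q category.Id_simps[OF q] normed_category.nrm_Id[OF cocones_ncat(1) q(2)]
    unfolding x by (auto simp: fam_cat_def dom_fam_def cod_fam_def comp_fam_def intro!: restrict_ext INF_greatest)
qed

lemma arrfun_inclusion:
  assumes i: "i \<in> Obj J" shows "arrfun (ObjMap D i) fam_cat (inclusion i)"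
proof (rule arrfunI)
  fix f assume f: "f \<in> Arr (ObjMap D i)"
  note a = arrfunD[OF cocones_arrfun(2)[OF _ i] f]
  show "inclusion i f \<in> Arr fam_cat" using inclusion_in[OF i f] by (simp add: fam_cat_def)
  show "nrm (ObjMap D i) f \<le> nrm fam_cat (inclusion i f)"
    using a(2) by (auto simp: fam_cat_def inclusion_def comp_fam_def intro!: INF_greatest)
  show "inclusion i (Id (ObjMap D i) (Dom (ObjMap D i) f)) = Id fam_cat (Dom fam_cat (inclusion i f))"
    "inclusion i (Id (ObjMap D i) (Cod (ObjMap D i) f)) = Id fam_cat (Cod fam_cat (inclusion i f))"
    using inclusion_Id[OF i f] by (simp_all add: fam_cat_def)
  fix g assume g: "g \<in> Arr (ObjMap D i)" "Cod (ObjMap D i) f = Dom (ObjMap D i) g"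
  show "inclusion i (Comp (ObjMap D i) g f) = Comp fam_cat (inclusion i g) (inclusion i f)"
    using arrfun_Comp[OF cocones_arrfun(2)[OF _ i] f g]
    by (auto simp: fam_cat_def inclusion_def comp_fam_def intro!: restrict_ext)
qed

lemma arrfun_eval:
  assumes q: "q \<in> cocones" shows "arrfun fam_cat (fst q) (\<lambda>p. p q)"
  by (rule arrfunI)
    (use q families_arr in \<open>auto simp: fam_cat_def dom_fam_def cod_fam_def comp_fam_def intro!: INF_lower\<close>)

text \<open>A cocone is itself an index of the product, so evaluation at it is the mediating
  functor; uniqueness is an induction over the generation of \<open>families\<close> from the images
  of the stages. However many cocones there are, the families are few, being generated by a small
  union of small sets.\<close>

lemma ex_colimit:
  assumes U: "universe TYPE('u)" and J: "small TYPE('u) (Obj J)"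
  shows "\<exists>c t. is_colimit J Cat_normed D c t"
proof -
  have small: "small TYPE('u) families"
    unfolding families_def
    by (intro small_op_closure U small_UNION J small_image small_ncatsD(4) D_obj)
  then obtain e :: "_ \<Rightarrow> 'u" where e: "inj_on e families" using small_ex_inj by blast
  have e': "inj_on e (Arr fam_cat)" using e by (simp add: fam_cat_def)
  note tr = normed_category_fam_cat e'
  define c where "c = transport fam_cat e"
  have c: "c \<in> small_ncats"
    unfolding c_def by (rule transport_small_ncats[OF tr]) (use small in \<open>simp add: fam_cat_def\<close>)
  have cc: "category c" "category fam_cat"
    using c small_ncatsD(2) normed_category_fam_cat normed_category_category by blast+
  have arr_c: "Arr c = e ` families" unfolding c_def transport_simps(2)[OF tr] by (simp add: fam_cat_def)
  define t where "t i = arrow_of (ObjMap D i) (e \<circ> inclusion i) c" for i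
  have t: "t i \<in> hom Cat_normed (ObjMap D i) c" if "i \<in> Obj J" for i
    unfolding t_def
  proof (rule hom_Cat_normedI[OF D_obj[OF that] c])
    show "arrfun (ObjMap D i) c (e \<circ> inclusion i)"
      unfolding c_def
      by (rule arrfun_compose[OF small_ncatsD(2)[OF D_obj[OF that]] cc(2) arrfun_inclusion[OF that]
            arrfun_transport[OF tr]])
  qed
  have t_arr: "arrmap (t i) f = e (inclusion i f)" if "f \<in> Arr (ObjMap D i)" for i f
    unfolding t_def arrmap_arrow_of[OF that] by simp
  have cocone: "is_cocone J Cat_normed D c t"
    unfolding is_cocone_def
  proof (intro conjI ballI)
    fix u assume u: "u \<in> Arr J"
    note Du = D_arr[OF u] and ob = J_obj[OF u]
    show "Comp Cat_normed (t (Cod J u)) (ArrMap D u) = t (Dom J u)"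
    proof (rule Cat_normed_eqI[OF Comp_Cat_normed(2)[OF Du t[OF ob(2)]] t[OF ob(1)]])
      fix f assume f: "f \<in> Arr (ObjMap D (Dom J u))"
      have Df: "arrmap (ArrMap D u) f \<in> Arr (ObjMap D (Cod J u))"
        by (rule arrfunD(1)[OF hom_Cat_normedD(3)[OF Du] f])
      have "inclusion (Cod J u) (arrmap (ArrMap D u) f) = inclusion (Dom J u) f"
        unfolding inclusion_def
      proof (rule restrict_ext)
        fix q assume q: "q \<in> cocones"
        then have "Comp Cat_normed (snd q (Cod J u)) (ArrMap D u) = snd q (Dom J u)"
          using is_cocone_Cat_normedD(3) u unfolding cocones_def by fastforce
        then show "arrmap (snd q (Cod J u)) (arrmap (ArrMap D u) f) = arrmap (snd q (Dom J u)) f"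
          using Comp_Cat_normed(3)[OF Du cocones_arrfun(1)[OF q ob(2)] f] by simp
      qed
      then show "arrmap (Comp Cat_normed (t (Cod J u)) (ArrMap D u)) f = arrmap (t (Dom J u)) f"
        unfolding Comp_Cat_normed(3)[OF Du t[OF ob(2)] f] t_arr[OF Df] t_arr[OF f] by simp
    qed
  qed (use c t in auto)
  have "is_colimit J Cat_normed D c t"
    unfolding is_colimit_def
  proof (intro conjI cocone allI impI)
    fix c' t' assume ct': "is_cocone J Cat_normed D c' t'"
    define q where "q = (c', t')"
    have q: "q \<in> cocones" using ct' by (simp add: q_def cocones_def)
    have c': "c' \<in> small_ncats" and t': "i \<in> Obj J \<Longrightarrow> t' i \<in> hom Cat_normed (ObjMap D i) c'" for i
      using is_cocone_Cat_normedD[OF ct'] by auto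
    define h where "h = arrow_of c ((\<lambda>p. p q) \<circ> inv_into (Arr fam_cat) e) c'"
    have h: "h \<in> hom Cat_normed c c'"
      unfolding h_def
    proof (rule hom_Cat_normedI[OF c c'])
      have "arrfun fam_cat c' (\<lambda>p. p q)" using arrfun_eval[OF q] by (simp add: q_def)
      then show "arrfun c c' ((\<lambda>p. p q) \<circ> inv_into (Arr fam_cat) e)"
        using arrfun_compose[OF cc arrfun_inv_transport[OF tr, folded c_def]] by blast
    qed
    have h_arr: "arrmap h (e p) = p q" if "p \<in> families" for p
      using that e unfolding h_def by (subst arrmap_arrow_of) (auto simp: arr_c fam_cat_def)
    show "\<exists>!h. h \<in> hom Cat_normed c c' \<and> (\<forall>i\<in>Obj J. Comp Cat_normed h (t i) = t' i)"
    proof (rule ex1I[of _ h], intro conjI ballI h)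
      fix i assume i: "i \<in> Obj J"
      show "Comp Cat_normed h (t i) = t' i"
      proof (rule Cat_normed_eqI[OF Comp_Cat_normed(2)[OF t[OF i] h] t'[OF i]])
        fix f assume f: "f \<in> Arr (ObjMap D i)"
        show "arrmap (Comp Cat_normed h (t i)) f = arrmap (t' i) f"
          unfolding Comp_Cat_normed(3)[OF t[OF i] h f] t_arr[OF f] h_arr[OF inclusion_in[OF i f]]
          using q by (simp add: inclusion_def q_def)
      qed
    next
      fix k assume k: "k \<in> hom Cat_normed c c' \<and> (\<forall>i\<in>Obj J. Comp Cat_normed k (t i) = t' i)"
      then have k1: "k \<in> hom Cat_normed c c'" by blast
      have "arrmap k (e p) = p q" if p: "p \<in> families" for p
        using p[unfolded families_def]
      proof (induction rule: op_closure.induct)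
        case (gen p)
        then obtain i f where i: "i \<in> Obj J" and f: "f \<in> Arr (ObjMap D i)" and p: "p = inclusion i f"
          by blast
        have "arrmap k (e p) = arrmap (t' i) f"
          using Comp_Cat_normed(3)[OF t[OF i] k1 f] k i t_arr[OF f] p by simp
        also have "\<dots> = p q" using q by (simp add: p inclusion_def q_def)
        finally show ?case .
      next
        case (op p p')
        have pp': "p \<in> families" "p' \<in> families" using op.hyps(1,2) unfolding families_def by -
        have comp: "cod_fam p = dom_fam p'"
          using op.hyps(3) by (auto simp: dom_fam_def cod_fam_def comp_fam_def intro!: restrict_ext)
        have fc: "p \<in> Arr fam_cat" "p' \<in> Arr fam_cat" "Cod fam_cat p = Dom fam_cat p'"
          using pp' comp by (auto simp: fam_cat_def)
        have m: "comp_fam p' p = Comp fam_cat p' p" by (simp add: fam_cat_def)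
        have em: "e (comp_fam p' p) = Comp c (e p') (e p)"
          unfolding m c_def transport_simps(6)[OF tr fc] ..
        have cd: "Cod c (e p) = Dom c (e p')"
          unfolding c_def by (rule arrfun_composable[OF cc(1)[unfolded c_def] arrfun_transport[OF tr] fc])
        have "arrmap k (e (comp_fam p' p)) = Comp c' (arrmap k (e p')) (arrmap k (e p))"
          unfolding em
          by (rule arrfun_Comp[OF hom_Cat_normedD(3)[OF k1]]) (use pp' cd in \<open>auto simp: arr_c\<close>)
        also have "\<dots> = comp_fam p' p q" using op.IH q by (simp add: q_def comp_fam_def)
        finally show ?case .
      qed
      then show "k = h"
        by (intro Cat_normed_eqI[OF k1 h]) (auto simp: arr_c h_arr)
    qed
  qed
  then show ?thesis by blast
qed

end

lemma cocomplete_Cat_normed: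
  assumes "universe TYPE('u)"
  shows "cocomplete TYPE('u) (Cat_normed :: (('u, 'u, 'v::quantale) ncat, _) cat)"
  unfolding cocomplete_def using diagram.ex_colimit[OF diagram.intro assms] by blast

section \<open>Directed colimits\<close>

text \<open>\<open>bound\<close> is directedness for the successor of \<open>|K|\<close>.
  \<open>K_values\<close> makes norms attained, and \<open>K_inf\<close> lets finitely many stages
  be bounded as well.\<close>

locale directed_diagram = diagram "poset_cat P r" D
  for P :: "'i set" and r :: "'i rel"
    and D :: "('i, 'i \<times> 'i, ('u, 'u, 'v::quantale) ncat,
      ('u, 'u, 'v) ncat \<times> ('u, 'u, 'u, 'u) functor_map \<times> ('u, 'u, 'v) ncat) functor_map"
    and K :: "'k set" +
  assumes po: "partial_order_on P r"
    and bound: "S \<subseteq> P \<Longrightarrow> |S| \<le>o |K| \<Longrightarrow> \<exists>b\<in>P. \<forall>s\<in>S. (s, b) \<in> r"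
    and K_inf: "infinite K" and K_values: "|UNIV :: 'v set| \<le>o |K|"
begin

abbreviation "E i \<equiv> ObjMap D i"
abbreviation "M i j \<equiv> arrmap (ArrMap D (i, j))"

lemma r_P: assumes "(i, j) \<in> r" shows "i \<in> P" "j \<in> P"
  using po assms unfolding partial_order_on_def preorder_on_def by blast+

lemma r_refl: "i \<in> P \<Longrightarrow> (i, i) \<in> r"
  using po unfolding partial_order_on_def preorder_on_def refl_on_def by blast

lemma r_trans: "(i, j) \<in> r \<Longrightarrow> (j, k) \<in> r \<Longrightarrow> (i, k) \<in> r"
  using po unfolding partial_order_on_def preorder_on_def by (blast dest: transD)

lemma E_small: "i \<in> P \<Longrightarrow> E i \<in> small_ncats"
  using D_obj[of i] by (simp add: poset_cat_def)

lemma E_cat: "i \<in> P \<Longrightarrow> category (E i)"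
  using E_small small_ncatsD(2) by blast

lemma M_hom: "(i, j) \<in> r \<Longrightarrow> ArrMap D (i, j) \<in> hom Cat_normed (E i) (E j)"
  using D_arr[of "(i, j)"] by (simp add: poset_cat_def)

lemma M_arrfun: "(i, j) \<in> r \<Longrightarrow> arrfun (E i) (E j) (M i j)"
  by (rule hom_Cat_normedD(3)[OF M_hom])

lemma M_arr: "(i, j) \<in> r \<Longrightarrow> f \<in> Arr (E i) \<Longrightarrow> M i j f \<in> Arr (E j)"
  by (rule arrfunD(1)[OF M_arrfun])

lemma M_Comp:
  assumes "(i, j) \<in> r" "(j, k) \<in> r" "f \<in> Arr (E i)"
  shows "M j k (M i j f) = M i k f"
proof -
  have "ArrMap D (Comp (poset_cat P r) (j, k) (i, j)) =
      Comp Cat_normed (ArrMap D (j, k)) (ArrMap D (i, j))"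
    using assms by (intro is_functor.ArrMap_Comp[OF D]) (auto simp: hom_def poset_cat_def)
  then show ?thesis
    using Comp_Cat_normed(3)[OF M_hom[OF assms(1)] M_hom[OF assms(2)] assms(3)]
    by (simp add: poset_cat_def)
qed

lemma finite_bound:
  assumes "i \<in> P" "j \<in> P" obtains k where "(i, k) \<in> r" "(j, k) \<in> r"
proof -
  have "|{i, j}| \<le>o |K|" using K_inf by (intro ordLess_imp_ordLeq finite_ordLess_infinite) (auto simp: Field_card_of card_of_well_order_on)
  then show ?thesis using bound[of "{i, j}"] assms that by auto
qed

text \<open>Choose a stage for each \<open>z\<close>, bound all of them and \<open>i\<close> by one
  stage, and let persistence carry every \<open>Q z\<close> there. This replaces the usual passage
  to a stage where finitely many conditions hold.\<close>

lemma family_bound: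
  assumes Z: "|Z| \<le>o |K|" and i: "i \<in> P"
    and ex: "\<And>z. z \<in> Z \<Longrightarrow> \<exists>j. (i, j) \<in> r \<and> Q z j"
    and mono: "\<And>z j k. z \<in> Z \<Longrightarrow> (i, j) \<in> r \<Longrightarrow> (j, k) \<in> r \<Longrightarrow> Q z j \<Longrightarrow> Q z k"
  obtains j where "(i, j) \<in> r" "\<And>z. z \<in> Z \<Longrightarrow> Q z j"
proof -
  obtain s where s: "\<And>z. z \<in> Z \<Longrightarrow> (i, s z) \<in> r \<and> Q z (s z)" using ex by metis
  have "|s ` Z| \<le>o |K|" using Z card_of_image ordLeq_transitive by blast
  moreover have "s ` Z \<subseteq> P" using r_P(2) s by (metis image_subsetI)
  ultimately obtain b where b: "b \<in> P" "\<And>z. z \<in> Z \<Longrightarrow> (s z, b) \<in> r"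
    using bound[of "s ` Z"] by (metis imageI)
  obtain j where j: "(i, j) \<in> r" "(b, j) \<in> r" using finite_bound[OF i b(1)] .
  show ?thesis
  proof (rule that[OF j(1)])
    fix z assume "z \<in> Z"
    then show "Q z j" using mono s b j r_trans by metis
  qed
qed

section \<open>Recognizing directed colimits by their arrows\<close>

definition compatible where
  "compatible s \<longleftrightarrow> (\<forall>i j. (i, j) \<in> r \<longrightarrow> (\<forall>f \<in> Arr (E i). s j (M i j f) = s i f))"

text \<open>Together with joint surjectivity this characterizes directed colimits of sets: only what
  agrees at a later stage is identified. The target type of \<open>s\<close> is left open, so that
  legs of cocones and germs are covered alike.\<close>

definition separating where
  "separating s \<longleftrightarrow> compatible s \<and>
     (\<forall>i \<in> P. \<forall>f \<in> Arr (E i). \<forall>g \<in> Arr (E i). s i f = s i g \<longrightarrow> (\<exists>j. (i, j) \<in> r \<and> M i j f = M i j g))"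

lemma compatibleD: "compatible s \<Longrightarrow> (i, j) \<in> r \<Longrightarrow> f \<in> Arr (E i) \<Longrightarrow> s j (M i j f) = s i f"
  unfolding compatible_def by blast

lemma separating_compatible: "separating s \<Longrightarrow> compatible s"
  unfolding separating_def by blast

text \<open>Push both arrows to a common stage and separate them there.\<close>

lemma separating_eqD:
  assumes s: "separating s" and i: "i \<in> P" "f \<in> Arr (E i)" and j: "j \<in> P" "g \<in> Arr (E j)"
    and eq: "s i f = s j g"
  obtains k where "(i, k) \<in> r" "(j, k) \<in> r" "M i k f = M j k g"
proof -
  obtain k where k: "(i, k) \<in> r" "(j, k) \<in> r" using finite_bound[OF i(1) j(1)] .
  note c = compatibleD[OF separating_compatible[OF s]]
  have "s k (M i k f) = s k (M j k g)" using c[OF k(1) i(2)] c[OF k(2) j(2)] eq by simp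
  then obtain l where l: "(k, l) \<in> r" "M k l (M i k f) = M k l (M j k g)"
    using s M_arr[OF k(1) i(2)] M_arr[OF k(2) j(2)] r_P(2)[OF k(1)] unfolding separating_def by blast
  show ?thesis
    using that[OF r_trans[OF k(1) l(1)] r_trans[OF k(2) l(1)]] l(2)
      M_Comp[OF k(1) l(1) i(2)] M_Comp[OF k(2) l(1) j(2)] by simp
qed

lemma separating_compatible_eq:
  assumes s: "separating s" and s': "compatible s'" and i: "i \<in> P" "f \<in> Arr (E i)"
    and j: "j \<in> P" "g \<in> Arr (E j)" and eq: "s i f = s j g"
  shows "s' i f = s' j g"
  using separating_eqD[OF s i j eq] compatibleD[OF s'] i j by metis

text \<open>The map that \<open>s'\<close> induces on the colimit. For separating \<open>s\<close>
  and compatible \<open>s'\<close> the choice is harmless, by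
  \<open>separating_compatible_eq\<close>.\<close>

definition descend where
  "descend s s' p = (SOME y. \<exists>i\<in>P. \<exists>f\<in>Arr (E i). s i f = p \<and> y = s' i f)"

lemma descend_eq:
  assumes "separating s" "compatible s'" "i \<in> P" "f \<in> Arr (E i)"
  shows "descend s s' (s i f) = s' i f"
  unfolding descend_def
proof (rule some_equality)
  show "\<exists>j\<in>P. \<exists>g\<in>Arr (E j). s j g = s i f \<and> s' i f = s' j g" using assms(3,4) by blast
  fix y assume "\<exists>j\<in>P. \<exists>g\<in>Arr (E j). s j g = s i f \<and> y = s' j g"
  then obtain j g where j: "j \<in> P" "g \<in> Arr (E j)" "s j g = s i f" and y: "y = s' j g" by blast
  show "y = s' i f"
    unfolding y by (rule separating_compatible_eq[OF assms(1,2) j(1,2) assms(3,4) j(3)])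
qed

text \<open>For \<open>s = germ\<close> these are the families from which \<open>Dom\<close> and
  \<open>Cod\<close> of \<open>germ_cat\<close> descend.\<close>

lemma compatible_Dom_Cod:
  assumes "compatible s"
  shows "compatible (\<lambda>i f. s i (Id (E i) (Dom (E i) f)))" "compatible (\<lambda>i f. s i (Id (E i) (Cod (E i) f)))"
proof -
  have "s j (Id (E j) (Dom (E j) (M i j f))) = s i (Id (E i) (Dom (E i) f))"
    "s j (Id (E j) (Cod (E j) (M i j f))) = s i (Id (E i) (Cod (E i) f))"
    if ij: "(i, j) \<in> r" and f: "f \<in> Arr (E i)" for i j f
  proof -
    interpret category "E i" using E_cat r_P(1)[OF ij] .
    show "s j (Id (E j) (Dom (E j) (M i j f))) = s i (Id (E i) (Dom (E i) f))"
      "s j (Id (E j) (Cod (E j) (M i j f))) = s i (Id (E i) (Cod (E i) f))"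
      using arrfunD(3,4)[OF M_arrfun[OF ij] f, symmetric] f
      by (simp_all add: compatibleD[OF assms ij])
  qed
  then show "compatible (\<lambda>i f. s i (Id (E i) (Dom (E i) f)))"
    "compatible (\<lambda>i f. s i (Id (E i) (Cod (E i) f)))"
    unfolding compatible_def by blast+
qed

lemma M_Id_Dom_Cod:
  assumes "(i, j) \<in> r" "f \<in> Arr (E i)"
  shows "Dom (E j) (M i j f) = Dom (E j) (M i j (Id (E i) (Dom (E i) f)))"
    "Cod (E j) (M i j f) = Dom (E j) (M i j (Id (E i) (Cod (E i) f)))"
  using arrfunD(1,3,4)[OF M_arrfun[OF assms(1)] assms(2)] category.Id_simps[OF E_cat[OF r_P(2)[OF assms(1)]]]
    category.Dom_in[OF E_cat[OF r_P(2)[OF assms(1)]]] category.Cod_in[OF E_cat[OF r_P(2)[OF assms(1)]]]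
  by metis+

text \<open>Composability is an equation between identities, and an equation in the colimit holds at
  some later stage.\<close>

lemma separating_composable:
  assumes s: "separating s" and i: "i \<in> P" "f \<in> Arr (E i)" and j: "j \<in> P" "g \<in> Arr (E j)"
    and eq: "s i (Id (E i) (Cod (E i) f)) = s j (Id (E j) (Dom (E j) g))"
  obtains k where "(i, k) \<in> r" "(j, k) \<in> r" "Cod (E k) (M i k f) = Dom (E k) (M j k g)"
proof -
  have "Id (E i) (Cod (E i) f) \<in> Arr (E i)" "Id (E j) (Dom (E j) g) \<in> Arr (E j)"
    using E_cat[OF i(1)] E_cat[OF j(1)] i j
    by (simp_all add: category.Id_simps category.Dom_in category.Cod_in)
  from separating_eqD[OF s i(1) this(1) j(1) this(2) eq] that M_Id_Dom_Cod i j
  show ?thesis by metis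
qed

text \<open>Every representative \<open>g\<close> agrees with \<open>f\<close> from some stage on,
  and there the image of \<open>f\<close> has norm at least that of \<open>g\<close>.
  \<open>family_bound\<close> finds one stage that serves all representatives.\<close>

lemma norm_attained:
  assumes s: "separating s" and i: "i \<in> P" "f \<in> Arr (E i)"
  obtains k where "(i, k) \<in> r"
    "\<And>j g. j \<in> P \<Longrightarrow> g \<in> Arr (E j) \<Longrightarrow> s j g = s i f \<Longrightarrow> nrm (E j) g \<le> nrm (E k) (M i k f)"
proof -
  \<comment> \<open>The representatives may outnumber \<open>K\<close>, the values of their norms do
    not; so the conditions are indexed by values.\<close>
  define V where "V = {nrm (E j) g |j g. j \<in> P \<and> g \<in> Arr (E j) \<and> s j g = s i f}"
  have "|V| \<le>o |K|" by (rule ordLeq_transitive[OF card_of_mono1[OF subset_UNIV] K_values])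
  then obtain k where k: "(i, k) \<in> r" "\<And>v. v \<in> V \<Longrightarrow> v \<le> nrm (E k) (M i k f)"
  proof (rule family_bound[OF _ i(1), where Q = "\<lambda>v j. v \<le> nrm (E j) (M i j f)"])
    fix v assume "v \<in> V"
    then obtain j g where j: "j \<in> P" "g \<in> Arr (E j)" "s i f = s j g" and v: "v = nrm (E j) g"
      unfolding V_def by force
    obtain k where k: "(i, k) \<in> r" "(j, k) \<in> r" "M i k f = M j k g"
      using separating_eqD[OF s i j] .
    then show "\<exists>k. (i, k) \<in> r \<and> v \<le> nrm (E k) (M i k f)"
      using arrfunD(2)[OF M_arrfun[OF k(2)] j(2)] v by auto
  next
    fix v j k assume ij: "(i, j) \<in> r" and jk: "(j, k) \<in> r" and v: "v \<le> nrm (E j) (M i j f)"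
    show "v \<le> nrm (E k) (M i k f)"
      using order_trans[OF v arrfunD(2)[OF M_arrfun[OF jk] M_arr[OF ij i(2)]]]
      by (simp add: M_Comp[OF ij jk i(2)])
  qed blast
  show ?thesis by (rule that[OF k(1) k(2)]) (auto simp: V_def)
qed

text \<open>As the legs are norm-compatible, the last inequality is an equality: each arrow has a
  representative of its own norm.\<close>

definition concrete where
  "concrete c t \<longleftrightarrow> is_cocone (poset_cat P r) Cat_normed D c t \<and> separating (\<lambda>i. arrmap (t i)) \<and>
     (\<forall>p \<in> Arr c. \<exists>i \<in> P. \<exists>f \<in> Arr (E i). arrmap (t i) f = p \<and> nrm c p \<le> nrm (E i) f)"

lemma cocone_hom:
  assumes "is_cocone (poset_cat P r) Cat_normed D c t"
  shows "c \<in> small_ncats" "i \<in> P \<Longrightarrow> t i \<in> hom Cat_normed (E i) c"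
    "i \<in> P \<Longrightarrow> arrfun (E i) c (arrmap (t i))"
proof -
  show c: "c \<in> small_ncats" and t: "i \<in> P \<Longrightarrow> t i \<in> hom Cat_normed (E i) c" for i
    using is_cocone_Cat_normedD(1,2)[OF assms] by (auto simp: poset_cat_def)
  show "i \<in> P \<Longrightarrow> arrfun (E i) c (arrmap (t i))" by (rule hom_Cat_normedD(3)[OF t])
qed

lemma cocone_compatible:
  assumes t: "is_cocone (poset_cat P r) Cat_normed D c t"
  shows "compatible (\<lambda>i. arrmap (t i))"
  unfolding compatible_def
proof (intro allI impI ballI)
  fix i j f assume ij: "(i, j) \<in> r" and f: "f \<in> Arr (E i)"
  have "Comp Cat_normed (t j) (ArrMap D (i, j)) = t i"
    using is_cocone_Cat_normedD(3)[OF t, of "(i, j)"] ij by (simp add: poset_cat_def)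
  then show "arrmap (t j) (M i j f) = arrmap (t i) f"
    using Comp_Cat_normed(3)[OF M_hom[OF ij] cocone_hom(2)[OF t r_P(2)[OF ij]] f] by simp
qed

lemma is_coconeI:
  assumes c: "c \<in> small_ncats" and t: "\<And>i. i \<in> P \<Longrightarrow> t i \<in> hom Cat_normed (E i) c"
    and comp: "compatible (\<lambda>i. arrmap (t i))"
  shows "is_cocone (poset_cat P r) Cat_normed D c t"
proof -
  have "Comp Cat_normed (t j) (ArrMap D (i, j)) = t i" if ij: "(i, j) \<in> r" for i j
    by (rule Cat_normed_eqI[OF Comp_Cat_normed(2)[OF M_hom[OF ij] t[OF r_P(2)[OF ij]]] t[OF r_P(1)[OF ij]]])
      (simp add: Comp_Cat_normed(3)[OF M_hom[OF ij] t[OF r_P(2)[OF ij]]] compatibleD[OF comp ij])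
  then show ?thesis using c t by (auto simp: is_cocone_def poset_cat_def)
qed

text \<open>The induced map on arrows respects the norm because some representative attains it, and
  respects composition because a composable pair is represented by a composable pair at one
  stage.\<close>

lemma concrete_is_colimit:
  assumes ct: "concrete c t" shows "is_colimit (poset_cat P r) Cat_normed D c t"
proof -
  have cocone: "is_cocone (poset_cat P r) Cat_normed D c t" and sep: "separating (\<lambda>i. arrmap (t i))"
    and surj: "\<And>p. p \<in> Arr c \<Longrightarrow> \<exists>i \<in> P. \<exists>f \<in> Arr (E i). arrmap (t i) f = p \<and> nrm c p \<le> nrm (E i) f"
    using ct unfolding concrete_def by blast+
  note c = cocone_hom(1)[OF cocone] and t = cocone_hom(2,3)[OF cocone]
  show ?thesis
    unfolding is_colimit_def
  proof (intro conjI cocone allI impI)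
    fix c' t' assume cocone': "is_cocone (poset_cat P r) Cat_normed D c' t'"
    note c' = cocone_hom(1)[OF cocone'] and t' = cocone_hom(2,3)[OF cocone']
    define a where "a = descend (\<lambda>i. arrmap (t i)) (\<lambda>i. arrmap (t' i))"
    have a: "a (arrmap (t i) f) = arrmap (t' i) f" if "i \<in> P" "f \<in> Arr (E i)" for i f
      unfolding a_def by (rule descend_eq[OF sep cocone_compatible[OF cocone'] that])
    have a_arrfun: "arrfun c c' a"
    proof (rule arrfunI)
      fix p assume "p \<in> Arr c"
      then obtain i f where i: "i \<in> P" and f: "f \<in> Arr (E i)" and p: "p = arrmap (t i) f"
        and n: "nrm c p \<le> nrm (E i) f" using surj by metis
      have ids: "Id (E i) (Dom (E i) f) \<in> Arr (E i)" "Id (E i) (Cod (E i) f) \<in> Arr (E i)"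
        using E_cat[OF i] f by (simp_all add: category.Id_simps category.Dom_in category.Cod_in)
      show "a p \<in> Arr c'" "nrm c p \<le> nrm c' (a p)"
        "a (Id c (Dom c p)) = Id c' (Dom c' (a p))" "a (Id c (Cod c p)) = Id c' (Cod c' (a p))"
        using arrfunD[OF t'(2)[OF i] f] arrfunD(3,4)[OF t(2)[OF i] f, symmetric] n a[OF i f]
          a[OF i ids(1)] a[OF i ids(2)] by (auto simp: p)
    next
      fix p q assume pq: "p \<in> Arr c" "q \<in> Arr c" "Cod c p = Dom c q"
      then obtain i f j g where i: "i \<in> P" "f \<in> Arr (E i)" "p = arrmap (t i) f"
        and j: "j \<in> P" "g \<in> Arr (E j)" "q = arrmap (t j) g" using surj by metis
      have "arrmap (t i) (Id (E i) (Cod (E i) f)) = arrmap (t j) (Id (E j) (Dom (E j) g))"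
        using arrfunD(4)[OF t(2)[OF i(1)] i(2)] arrfunD(3)[OF t(2)[OF j(1)] j(2)] pq(3) i(3) j(3) by simp
      then obtain k where k: "(i, k) \<in> r" "(j, k) \<in> r" "Cod (E k) (M i k f) = Dom (E k) (M j k g)"
        using separating_composable[OF sep i(1,2) j(1,2)] by blast
      let ?f = "M i k f" and ?g = "M j k g"
      have kP: "k \<in> P" using r_P(2)[OF k(1)] .
      have fg: "?f \<in> Arr (E k)" "?g \<in> Arr (E k)" using M_arr k i j by auto
      have eq: "p = arrmap (t k) ?f" "q = arrmap (t k) ?g"
        using compatibleD[OF separating_compatible[OF sep]] k i j by auto
      have gf: "Comp (E k) ?g ?f \<in> Arr (E k)" by (rule category.Comp_simps(1)[OF E_cat[OF kP] fg k(3)])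
      show "a (Comp c q p) = Comp c' (a q) (a p)"
        using a[OF kP gf] arrfun_Comp[OF t(2)[OF kP] fg k(3)] arrfun_Comp[OF t'(2)[OF kP] fg k(3)]
          a[OF kP fg(1)] a[OF kP fg(2)] by (simp add: eq)
    qed
    define h where "h = arrow_of c a c'"
    have h: "h \<in> hom Cat_normed c c'" unfolding h_def by (rule hom_Cat_normedI[OF c c' a_arrfun])
    have h_arr: "arrmap h p = a p" if "p \<in> Arr c" for p
      unfolding h_def by (rule arrmap_arrow_of[OF that])
    have t_arr: "arrmap (t i) f \<in> Arr c" if "i \<in> P" "f \<in> Arr (E i)" for i f
      by (rule arrfunD(1)[OF t(2)[OF that(1)] that(2)])
    have "\<exists>!h. h \<in> hom Cat_normed c c' \<and> (\<forall>i\<in>P. Comp Cat_normed h (t i) = t' i)"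
    proof (rule ex1I[of _ h], intro conjI ballI h)
      fix i assume i: "i \<in> P"
      show "Comp Cat_normed h (t i) = t' i"
        by (rule Cat_normed_eqI[OF Comp_Cat_normed(2)[OF t(1)[OF i] h] t'(1)[OF i]])
          (simp add: Comp_Cat_normed(3)[OF t(1)[OF i] h] h_arr t_arr[OF i] a[OF i])
    next
      fix k assume k: "k \<in> hom Cat_normed c c' \<and> (\<forall>i\<in>P. Comp Cat_normed k (t i) = t' i)"
      then have k1: "k \<in> hom Cat_normed c c'" by blast
      show "k = h"
      proof (rule Cat_normed_eqI[OF k1 h])
        fix p assume p: "p \<in> Arr c"
        then obtain i f where i: "i \<in> P" "f \<in> Arr (E i)" "p = arrmap (t i) f" using surj by metis
        have "arrmap k p = arrmap (t' i) f"
          using Comp_Cat_normed(3)[OF t(1)[OF i(1)] k1 i(2)] k i by simp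
        then show "arrmap k p = arrmap h p" using h_arr[OF p] a[OF i(1,2)] i(3) by simp
      qed
    qed
    then show "\<exists>!h. h \<in> hom Cat_normed c c' \<and>
        (\<forall>i\<in>Obj (poset_cat P r). Comp Cat_normed h (t i) = t' i)" by (simp add: poset_cat_def)
  qed
qed

section \<open>The directed colimit built from germs\<close>

definition germ where
  "germ i f = {(j, g). j \<in> P \<and> g \<in> Arr (E j) \<and> (\<exists>k. (i, k) \<in> r \<and> (j, k) \<in> r \<and> M i k f = M j k g)}"

text \<open>Compatibility compares stages above a common bound. For separation,
  \<open>(i, g)\<close> belongs to its own germ by reflexivity, hence to that of \<open>f\<close>,
  which says that \<open>f\<close> and \<open>g\<close> agree later.\<close>

lemma separating_germ: "separating germ"
  unfolding separating_def
proof (intro conjI ballI impI)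
  show "compatible germ"
    unfolding compatible_def
  proof (intro allI impI ballI)
    fix i j f assume ij: "(i, j) \<in> r" and f: "f \<in> Arr (E i)"
    have "(\<exists>k. (j, k) \<in> r \<and> (l, k) \<in> r \<and> M j k (M i j f) = M l k g) \<longleftrightarrow>
        (\<exists>k. (i, k) \<in> r \<and> (l, k) \<in> r \<and> M i k f = M l k g)"
      if l: "l \<in> P" "g \<in> Arr (E l)" for l g
    proof
      assume "\<exists>k. (j, k) \<in> r \<and> (l, k) \<in> r \<and> M j k (M i j f) = M l k g"
      then show "\<exists>k. (i, k) \<in> r \<and> (l, k) \<in> r \<and> M i k f = M l k g"
        using r_trans[OF ij] M_Comp[OF ij _ f] by metis
    next
      assume "\<exists>k. (i, k) \<in> r \<and> (l, k) \<in> r \<and> M i k f = M l k g"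
      then obtain k where k: "(i, k) \<in> r" "(l, k) \<in> r" "M i k f = M l k g" by blast
      obtain m where m: "(j, m) \<in> r" "(k, m) \<in> r" using finite_bound r_P(2) ij k(1) by metis
      have "M j m (M i j f) = M l m g"
        using M_Comp[OF ij m(1) f] M_Comp[OF k(1) m(2) f] M_Comp[OF k(2) m(2) l(2)] k(3) by simp
      then show "\<exists>k. (j, k) \<in> r \<and> (l, k) \<in> r \<and> M j k (M i j f) = M l k g"
        using m(1) r_trans[OF k(2) m(2)] by blast
    qed
    then show "germ j (M i j f) = germ i f" unfolding germ_def by auto
  qed
  fix i f g assume i: "i \<in> P" "f \<in> Arr (E i)" "g \<in> Arr (E i)" "germ i f = germ i g"
  then have "(i, g) \<in> germ i g" unfolding germ_def using r_refl[OF i(1)] by auto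
  then have "(i, g) \<in> germ i f" using i(4) by simp
  then show "\<exists>j. (i, j) \<in> r \<and> M i j f = M i j g" unfolding germ_def by blast
qed

definition germs where "germs = (\<Union>i\<in>P. germ i ` Arr (E i))"

text \<open>Objects are germs of identities, so \<open>Id\<close> is the identity function.
  \<open>Comp\<close> chooses composable representatives at a common stage; by
  \<open>germ_cat_Comp\<close> the result does not depend on the choice.\<close>

definition germ_cat where
  "germ_cat = \<lparr>Obj = (\<Union>i\<in>P. (\<lambda>x. germ i (Id (E i) x)) ` Obj (E i)), Arr = germs,
     Dom = descend germ (\<lambda>i f. germ i (Id (E i) (Dom (E i) f))),
     Cod = descend germ (\<lambda>i f. germ i (Id (E i) (Cod (E i) f))),
     Id = (\<lambda>x. x),
     Comp = (\<lambda>q p. SOME w. \<exists>i\<in>P. \<exists>f\<in>Arr (E i). \<exists>g\<in>Arr (E i).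
       p = germ i f \<and> q = germ i g \<and> Cod (E i) f = Dom (E i) g \<and> w = germ i (Comp (E i) g f)),
     nrm = (\<lambda>p. Sup {nrm (E i) f |i f. i \<in> P \<and> f \<in> Arr (E i) \<and> germ i f = p})\<rparr>"

lemmas germ_M = compatibleD[OF separating_compatible[OF separating_germ]]

lemma germ_cat_Dom_Cod:
  assumes "i \<in> P" "f \<in> Arr (E i)"
  shows "Dom germ_cat (germ i f) = germ i (Id (E i) (Dom (E i) f))"
    "Cod germ_cat (germ i f) = germ i (Id (E i) (Cod (E i) f))"
  using descend_eq[OF separating_germ _ assms]
    compatible_Dom_Cod[OF separating_compatible[OF separating_germ]]
  by (auto simp: germ_cat_def)

lemma germ_cat_Arr: "i \<in> P \<Longrightarrow> f \<in> Arr (E i) \<Longrightarrow> germ i f \<in> Arr germ_cat"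
  by (auto simp: germ_cat_def germs_def)

text \<open>Two pairs of representatives agree in the first factor at a stage \<open>k\<close> and
  in the second at a stage \<open>l\<close>, hence in both at a bound \<open>m\<close>; the
  transition functors preserve composites.\<close>

lemma germ_cat_Comp:
  assumes i: "i \<in> P" and f: "f \<in> Arr (E i)" and g: "g \<in> Arr (E i)" and fg: "Cod (E i) f = Dom (E i) g"
  shows "Comp germ_cat (germ i g) (germ i f) = germ i (Comp (E i) g f)"
proof -
  have "germ j (Comp (E j) g' f') = germ i (Comp (E i) g f)"
    if j: "j \<in> P" and f': "f' \<in> Arr (E j)" and g': "g' \<in> Arr (E j)" and fg': "Cod (E j) f' = Dom (E j) g'"
      and ef: "germ i f = germ j f'" and eg: "germ i g = germ j g'" for j f' g'
  proof -
    obtain k where k: "(i, k) \<in> r" "(j, k) \<in> r" "M i k f = M j k f'"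
      using separating_eqD[OF separating_germ i f j f' ef] .
    obtain l where l: "(i, l) \<in> r" "(j, l) \<in> r" "M i l g = M j l g'"
      using separating_eqD[OF separating_germ i g j g' eg] .
    obtain m where m: "(k, m) \<in> r" "(l, m) \<in> r" using finite_bound r_P(2) k(1) l(1) by metis
    have im: "(i, m) \<in> r" and jm: "(j, m) \<in> r" using r_trans k l m by blast+
    have "M i m f = M j m f'" using M_Comp[OF k(1) m(1) f] M_Comp[OF k(2) m(1) f'] k(3) by simp
    moreover have "M i m g = M j m g'" using M_Comp[OF l(1) m(2) g] M_Comp[OF l(2) m(2) g'] l(3) by simp
    ultimately have "M i m (Comp (E i) g f) = M j m (Comp (E j) g' f')"
      using arrfun_Comp[OF M_arrfun[OF im] f g fg] arrfun_Comp[OF M_arrfun[OF jm] f' g' fg'] by simp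
    then show ?thesis
      using germ_M[OF im category.Comp_simps(1)[OF E_cat[OF i] f g fg]]
        germ_M[OF jm category.Comp_simps(1)[OF E_cat[OF j] f' g' fg']] by simp
  qed
  note unique = this
  have "Comp germ_cat (germ i g) (germ i f) = (SOME w. \<exists>j\<in>P. \<exists>f'\<in>Arr (E j). \<exists>g'\<in>Arr (E j).
      germ i f = germ j f' \<and> germ i g = germ j g' \<and> Cod (E j) f' = Dom (E j) g' \<and>
      w = germ j (Comp (E j) g' f'))" (is "_ = (SOME w. ?Q w)")
    by (simp add: germ_cat_def)
  also have "\<dots> = germ i (Comp (E i) g f)"
  proof (rule some_equality)
    show "?Q (germ i (Comp (E i) g f))" using assms by blast
    fix w assume "?Q w"
    then show "w = germ i (Comp (E i) g f)" using unique by (elim bexE conjE) simp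
  qed
  finally show ?thesis .
qed

text \<open>By \<open>norm_attained\<close> the supremum that defines the norm is a maximum.\<close>

lemma germ_cat_nrm_attained:
  assumes "p \<in> Arr germ_cat"
  obtains i f where "i \<in> P" "f \<in> Arr (E i)" "p = germ i f" "nrm germ_cat p \<le> nrm (E i) f"
proof -
  obtain i f where i: "i \<in> P" and f: "f \<in> Arr (E i)" and p: "p = germ i f"
    using assms by (auto simp: germ_cat_def germs_def)
  obtain k where k: "(i, k) \<in> r"
    "\<And>j g. j \<in> P \<Longrightarrow> g \<in> Arr (E j) \<Longrightarrow> germ j g = germ i f \<Longrightarrow> nrm (E j) g \<le> nrm (E k) (M i k f)"
    by (rule norm_attained[OF separating_germ i f]) blast
  show ?thesis
  proof (rule that[OF r_P(2)[OF k(1)] M_arr[OF k(1) f]])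
    show "p = germ k (M i k f)" using germ_M[OF k(1) f] p by simp
    show "nrm germ_cat p \<le> nrm (E k) (M i k f)"
      using k(2) by (auto simp: germ_cat_def p intro!: Sup_least)
  qed
qed

lemma germ_cat_nrm_upper: "i \<in> P \<Longrightarrow> f \<in> Arr (E i) \<Longrightarrow> nrm (E i) f \<le> nrm germ_cat (germ i f)"
  by (auto simp: germ_cat_def intro!: Sup_upper)

text \<open>Norms only grow along the diagram, so both remain attained at the stage where the
  representatives become composable. The norm inequality for a composite of germs then reduces to
  the one in \<open>E i\<close>.\<close>

lemma germ_cat_composable:
  assumes pq: "p \<in> Arr germ_cat" "q \<in> Arr germ_cat" "Cod germ_cat p = Dom germ_cat q"
  obtains i f g where "i \<in> P" "f \<in> Arr (E i)" "g \<in> Arr (E i)" "p = germ i f" "q = germ i g"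
    "Cod (E i) f = Dom (E i) g" "nrm germ_cat p \<le> nrm (E i) f" "nrm germ_cat q \<le> nrm (E i) g"
proof -
  obtain i f where i: "i \<in> P" "f \<in> Arr (E i)" "p = germ i f" "nrm germ_cat p \<le> nrm (E i) f"
    using germ_cat_nrm_attained[OF pq(1)] .
  obtain j g where j: "j \<in> P" "g \<in> Arr (E j)" "q = germ j g" "nrm germ_cat q \<le> nrm (E j) g"
    using germ_cat_nrm_attained[OF pq(2)] .
  obtain k where k: "(i, k) \<in> r" "(j, k) \<in> r" "Cod (E k) (M i k f) = Dom (E k) (M j k g)"
    using separating_composable[OF separating_germ i(1,2) j(1,2)] pq(3)
      germ_cat_Dom_Cod[OF i(1,2)] germ_cat_Dom_Cod[OF j(1,2)] i(3) j(3) by metis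
  show ?thesis
    by (rule that[OF r_P(2)[OF k(1)] M_arr[OF k(1) i(2)] M_arr[OF k(2) j(2)] _ _ k(3)])
      (use germ_M[OF k(1) i(2)] germ_M[OF k(2) j(2)] i(3) j(3)
         order_trans[OF i(4) arrfunD(2)[OF M_arrfun[OF k(1)] i(2)]]
         order_trans[OF j(4) arrfunD(2)[OF M_arrfun[OF k(2)] j(2)]] in auto)
qed

text \<open>Each law involves finitely many germs and is checked on representatives at a single
  stage.\<close>

lemma normed_category_germ_cat: "normed_category germ_cat"
proof (rule normed_categoryI)
  fix p assume p: "p \<in> Arr germ_cat"
  then obtain i f where i: "i \<in> P" and f: "f \<in> Arr (E i)" and pf: "p = germ i f"
    by (auto simp: germ_cat_def germs_def)
  interpret Ei: category "E i" using E_cat[OF i] .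
  show "Dom germ_cat p \<in> Obj germ_cat \<and> Cod germ_cat p \<in> Obj germ_cat"
    unfolding pf germ_cat_Dom_Cod[OF i f]
    using i Ei.Dom_in[OF f] Ei.Cod_in[OF f] unfolding germ_cat_def by auto
  have "Comp germ_cat (germ i f) (germ i (Id (E i) (Dom (E i) f))) = germ i f"
    "Comp germ_cat (germ i (Id (E i) (Cod (E i) f))) (germ i f) = germ i f"
    using i f by (simp_all add: germ_cat_Comp)
  then show "Comp germ_cat p (Id germ_cat (Dom germ_cat p)) = p \<and>
      Comp germ_cat (Id germ_cat (Cod germ_cat p)) p = p"
    unfolding pf germ_cat_Dom_Cod[OF i f] by (simp add: germ_cat_def)
next
  fix x assume "x \<in> Obj germ_cat"
  then obtain i y where i: "i \<in> P" and y: "y \<in> Obj (E i)" and x: "x = germ i (Id (E i) y)"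
    by (auto simp: germ_cat_def)
  interpret Ei: normed_category "E i" using E_small[OF i] small_ncatsD(1) by blast
  have id: "Id germ_cat x = x" by (simp add: germ_cat_def)
  have iy: "Id (E i) y \<in> Arr (E i)" using y by simp
  show "Id germ_cat x \<in> Arr germ_cat \<and> Dom germ_cat (Id germ_cat x) = x \<and>
      Cod germ_cat (Id germ_cat x) = x \<and> 1 \<le> nrm germ_cat (Id germ_cat x)"
    unfolding id
    using germ_cat_Arr[OF i iy] germ_cat_Dom_Cod[OF i iy] y Ei.nrm_Id[OF y] germ_cat_nrm_upper[OF i iy]
    by (auto simp: x intro: order_trans)
next
  fix p q assume pq: "p \<in> Arr germ_cat" "q \<in> Arr germ_cat" "Cod germ_cat p = Dom germ_cat q"
  obtain i f g where i: "i \<in> P" "f \<in> Arr (E i)" "g \<in> Arr (E i)" and p: "p = germ i f" and q: "q = germ i g"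
    and c: "Cod (E i) f = Dom (E i) g" and n: "nrm germ_cat p \<le> nrm (E i) f" "nrm germ_cat q \<le> nrm (E i) g"
    using germ_cat_composable[OF pq] .
  have nc: "normed_category (E i)" using E_small[OF i(1)] small_ncatsD(1) by blast
  note cs = category.Comp_simps[OF E_cat[OF i(1)] i(2,3) c]
  have "nrm germ_cat p * nrm germ_cat q \<le> nrm (E i) f * nrm (E i) g"
    by (rule quantale_mult_mono[OF n])
  also have "\<dots> \<le> nrm (E i) (Comp (E i) g f)" by (rule normed_category_nrm_Comp[OF nc i(2,3) c])
  also have "\<dots> \<le> nrm germ_cat (germ i (Comp (E i) g f))" by (rule germ_cat_nrm_upper[OF i(1) cs(1)])
  finally show "Comp germ_cat q p \<in> Arr germ_cat \<and> Dom germ_cat (Comp germ_cat q p) = Dom germ_cat p \<and>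
      Cod germ_cat (Comp germ_cat q p) = Cod germ_cat q \<and>
      nrm germ_cat p * nrm germ_cat q \<le> nrm germ_cat (Comp germ_cat q p)"
    unfolding p q germ_cat_Comp[OF i c]
    using cs germ_cat_Arr[OF i(1) cs(1)] germ_cat_Dom_Cod[OF i(1)] i(2,3) by simp
  fix w assume w: "w \<in> Arr germ_cat" "Cod germ_cat q = Dom germ_cat w"
  obtain j g' h where j: "j \<in> P" "g' \<in> Arr (E j)" "h \<in> Arr (E j)" and q': "q = germ j g'" and wh: "w = germ j h"
    and c': "Cod (E j) g' = Dom (E j) h"
    using germ_cat_composable[OF pq(2) w] .
  \<comment> \<open>Both \<open>g\<close> and \<open>g'\<close> represent \<open>q\<close>. At a
    stage where they agree, the two composable pairs join into a composable triple.\<close>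
  obtain k where k: "(i, k) \<in> r" "(j, k) \<in> r" "M i k g = M j k g'"
    using separating_eqD[OF separating_germ i(1,3) j(1,2)] q q' by metis
  have kP: "k \<in> P" using r_P(2)[OF k(1)] .
  interpret Ek: category "E k" using E_cat[OF kP] .
  define F G H where "F = M i k f" and "G = M i k g" and "H = M j k h"
  have arr: "F \<in> Arr (E k)" "G \<in> Arr (E k)" "H \<in> Arr (E k)"
    using M_arr k i j by (auto simp: F_def G_def H_def)
  have g: "p = germ k F" "q = germ k G" "w = germ k H"
    using germ_M[OF k(1)] germ_M[OF k(2)] i j p q wh by (auto simp: F_def G_def H_def)
  have cd: "Cod (E k) F = Dom (E k) G" "Cod (E k) G = Dom (E k) H"
    using arrfun_composable[OF Ek.category_axioms M_arrfun[OF k(1)] i(2,3) c]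
      arrfun_composable[OF Ek.category_axioms M_arrfun[OF k(2)] j(2,3) c'] k(3)
    by (simp_all add: F_def G_def H_def)
  show "Comp germ_cat w (Comp germ_cat q p) = Comp germ_cat (Comp germ_cat w q) p"
    unfolding g using arr cd kP by (simp add: germ_cat_Comp Ek.Comp_assoc_arr)
qed

lemma arrfun_germ:
  assumes i: "i \<in> P" shows "arrfun (E i) germ_cat (germ i)"
proof (rule arrfunI)
  have id: "Id germ_cat x = x" for x by (simp add: germ_cat_def)
  fix f assume f: "f \<in> Arr (E i)"
  show "germ i f \<in> Arr germ_cat" "nrm (E i) f \<le> nrm germ_cat (germ i f)"
    "germ i (Id (E i) (Dom (E i) f)) = Id germ_cat (Dom germ_cat (germ i f))"
    "germ i (Id (E i) (Cod (E i) f)) = Id germ_cat (Cod germ_cat (germ i f))"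
    using germ_cat_Arr[OF i f] germ_cat_nrm_upper[OF i f] germ_cat_Dom_Cod[OF i f] by (simp_all add: id)
  fix g assume g: "g \<in> Arr (E i)" "Cod (E i) f = Dom (E i) g"
  show "germ i (Comp (E i) g f) = Comp germ_cat (germ i g) (germ i f)"
    using germ_cat_Comp[OF i f g] by simp
qed

text \<open>There are few germs, so \<open>transport\<close> can move them from a type of sets of
  pairs into \<open>'u\<close>.\<close>

lemma ex_concrete:
  assumes U: "universe TYPE('u)" and P: "small TYPE('u) P"
  shows "\<exists>c t. concrete c t"
proof -
  have small: "small TYPE('u) germs"
    unfolding germs_def by (intro small_UNION U P small_image small_ncatsD(4) E_small)
  then obtain e :: "_ \<Rightarrow> 'u" where e: "inj_on e germs" using small_ex_inj by blast
  have e': "inj_on e (Arr germ_cat)" using e by (simp add: germ_cat_def)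
  note tr = normed_category_germ_cat e'
  define c where "c = transport germ_cat e"
  have c: "c \<in> small_ncats"
    unfolding c_def by (rule transport_small_ncats[OF tr]) (use small in \<open>simp add: germ_cat_def\<close>)
  define t where "t i = arrow_of (E i) (e \<circ> germ i) c" for i
  have t_arr: "arrmap (t i) f = e (germ i f)" if "f \<in> Arr (E i)" for i f
    unfolding t_def arrmap_arrow_of[OF that] by simp
  have t: "t i \<in> hom Cat_normed (E i) c" if "i \<in> P" for i
    unfolding t_def
  proof (rule hom_Cat_normedI[OF E_small[OF that] c])
    show "arrfun (E i) c (e \<circ> germ i)"
      unfolding c_def
      by (rule arrfun_compose[OF E_cat[OF that] normed_category_category[OF tr(1)] arrfun_germ[OF that]
            arrfun_transport[OF tr]])
  qed
  have comp: "compatible (\<lambda>i. arrmap (t i))"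
    unfolding compatible_def by (simp add: t_arr M_arr germ_M)
  have sep: "separating (\<lambda>i. arrmap (t i))"
    unfolding separating_def
  proof (intro conjI comp ballI impI)
    fix i f g assume i: "i \<in> P" "f \<in> Arr (E i)" "g \<in> Arr (E i)" "arrmap (t i) f = arrmap (t i) g"
    have "germ i f = germ i g"
      using i(4) inj_onD[OF e', of "germ i f" "germ i g"] germ_cat_Arr i by (simp add: t_arr)
    then show "\<exists>j. (i, j) \<in> r \<and> M i j f = M i j g"
      using separating_germ i unfolding separating_def by blast
  qed
  have "\<exists>i\<in>P. \<exists>f\<in>Arr (E i). arrmap (t i) f = p \<and> nrm c p \<le> nrm (E i) f" if pc: "p \<in> Arr c" for p
  proof -
    obtain q where q: "q \<in> Arr germ_cat" "p = e q"
      using pc unfolding c_def transport_simps(2)[OF tr] by blast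
    obtain i f where i: "i \<in> P" "f \<in> Arr (E i)" "q = germ i f" "nrm germ_cat q \<le> nrm (E i) f"
      using germ_cat_nrm_attained[OF q(1)] .
    then show ?thesis using transport_simps(7)[OF tr q(1)] q(2) t_arr[OF i(2)] unfolding c_def by auto
  qed
  then have "concrete c t" unfolding concrete_def using is_coconeI[OF c t comp] sep by blast
  then show ?thesis by blast
qed

text \<open>The given colimit is compared with a concrete one by functors \<open>h\<close> and
  \<open>k\<close> whose composite on \<open>c\<close> is the identity. Equality of legs of
  \<open>c\<close> passes through \<open>h\<close> to the legs of \<open>l\<close>, which separate.
  A representative of \<open>h p\<close> with the norm of \<open>h p\<close> has norm at least that
  of \<open>p\<close>, and applying \<open>k\<close> shows that it represents
  \<open>p\<close>.\<close>

lemma colimit_concrete: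
  assumes U: "universe TYPE('u)" and P: "small TYPE('u) P"
    and ct: "is_colimit (poset_cat P r) Cat_normed D c t"
  shows "concrete c t"
proof -
  obtain l s where ls: "concrete l s" using ex_concrete[OF U P] by blast
  have col: "is_colimit (poset_cat P r) Cat_normed D l s" by (rule concrete_is_colimit[OF ls])
  have cc: "is_cocone (poset_cat P r) Cat_normed D c t" and lc: "is_cocone (poset_cat P r) Cat_normed D l s"
    using ct col unfolding is_colimit_def by auto
  have ob: "Obj (poset_cat P r) = P" by (simp add: poset_cat_def)
  obtain h where h: "h \<in> hom Cat_normed c l" "\<And>i. i \<in> P \<Longrightarrow> Comp Cat_normed h (t i) = s i"
    using ct lc unfolding is_colimit_def ob by blast
  obtain k where k: "k \<in> hom Cat_normed l c" "\<And>i. i \<in> P \<Longrightarrow> Comp Cat_normed k (s i) = t i"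
    using col cc unfolding is_colimit_def ob by blast
  note c = cocone_hom[OF cc] and l = cocone_hom[OF lc]
  have ha: "arrmap h (arrmap (t i) f) = arrmap (s i) f" and ka: "arrmap k (arrmap (s i) f) = arrmap (t i) f"
    if "i \<in> P" "f \<in> Arr (E i)" for i f
    using Comp_Cat_normed(3)[OF c(2)[OF that(1)] h(1) that(2)] h(2)[OF that(1)]
      Comp_Cat_normed(3)[OF l(2)[OF that(1)] k(1) that(2)] k(2)[OF that(1)] by simp_all
  \<comment> \<open>Both sides are endomorphisms of the colimit \<open>c\<close> that fix every
    leg.\<close>
  have kh: "Comp Cat_normed k h = Id Cat_normed c"
  proof -
    have "\<exists>!u. u \<in> hom Cat_normed c c \<and> (\<forall>i\<in>P. Comp Cat_normed u (t i) = t i)"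
      using ct cc unfolding is_colimit_def ob by blast
    moreover have "Comp Cat_normed (Comp Cat_normed k h) (t i) = t i" if "i \<in> P" for i
      using category.Comp_assoc[OF category_Cat_normed c(2)[OF that] h(1) k(1)] h(2) k(2) that by simp
    moreover have "Comp Cat_normed (Id Cat_normed c) (t i) = t i" if "i \<in> P" for i
      using category.Id_Comp[OF category_Cat_normed c(2)[OF that]] .
    ultimately show ?thesis
      using Comp_Cat_normed(2)[OF h(1) k(1)] Id_Cat_normed_hom[OF c(1)] by blast
  qed
  have sep: "separating (\<lambda>i. arrmap (t i))"
    unfolding separating_def
  proof (intro conjI cocone_compatible[OF cc] ballI impI)
    fix i f g assume i: "i \<in> P" "f \<in> Arr (E i)" "g \<in> Arr (E i)" "arrmap (t i) f = arrmap (t i) g"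
    have "arrmap (s i) f = arrmap (s i) g" using ha[OF i(1,2)] ha[OF i(1,3)] i(4) by simp
    then show "\<exists>j. (i, j) \<in> r \<and> M i j f = M i j g"
      using ls i unfolding concrete_def separating_def by blast
  qed
  have "\<exists>i\<in>P. \<exists>f\<in>Arr (E i). arrmap (t i) f = p \<and> nrm c p \<le> nrm (E i) f" if p: "p \<in> Arr c" for p
  proof -
    note hp = arrfunD(1,2)[OF hom_Cat_normedD(3)[OF h(1)] p]
    obtain i f where i: "i \<in> P" "f \<in> Arr (E i)" "arrmap (s i) f = arrmap h p" "nrm l (arrmap h p) \<le> nrm (E i) f"
      using ls hp(1) unfolding concrete_def by blast
    have "p = arrmap k (arrmap h p)"
      using Comp_Cat_normed(3)[OF h(1) k(1) p] kh arrmap_Id[OF c(1) p] by simp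
    also have "\<dots> = arrmap (t i) f" using ka[OF i(1,2)] i(3) by simp
    finally show ?thesis using i(1,2) order_trans[OF hp(2) i(4)] by auto
  qed
  then show ?thesis unfolding concrete_def using cc sep by blast
qed

end

section \<open>Presentable objects\<close>

definition set_fun where "set_fun u = fst (snd u)"

lemma hom_set_catI:
  "small U A \<Longrightarrow> small U B \<Longrightarrow> f \<in> A \<rightarrow>\<^sub>E B \<Longrightarrow> (A, f, B) \<in> hom (set_cat U) A B"
  by (simp add: hom_def set_cat_def)

lemma hom_set_catD:
  assumes "u \<in> hom (set_cat U) A B"
  shows "small U A" "small U B" "set_fun u \<in> A \<rightarrow>\<^sub>E B" "u = (A, set_fun u, B)"
  using assms by (auto simp: hom_def set_cat_def set_fun_def)

lemma set_cat_eqI: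
  assumes u: "u \<in> hom (set_cat U) A B" and v: "v \<in> hom (set_cat U) A B"
    and eq: "\<And>a. a \<in> A \<Longrightarrow> set_fun u a = set_fun v a"
  shows "u = v"
proof -
  have "set_fun u = set_fun v"
    using hom_set_catD(3)[OF u] hom_set_catD(3)[OF v] eq by (rule PiE_ext)
  then show ?thesis using hom_set_catD(4)[OF u] hom_set_catD(4)[OF v] by simp
qed

lemma Comp_set_cat:
  assumes u: "u \<in> hom (set_cat U) A B" and v: "v \<in> hom (set_cat U) B C"
  shows "Comp (set_cat U) v u \<in> hom (set_cat U) A C"
    "a \<in> A \<Longrightarrow> set_fun (Comp (set_cat U) v u) a = set_fun v (set_fun u a)"
proof -
  note u' = hom_set_catD[OF u] and v' = hom_set_catD[OF v]
  have eq: "Comp (set_cat U) v u = (A, compose A (set_fun v) (set_fun u), C)"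
    by (subst u'(4), subst v'(4)) (simp add: set_cat_def)
  show "Comp (set_cat U) v u \<in> hom (set_cat U) A C"
    unfolding eq by (rule hom_set_catI[OF u'(1) v'(2)]) (use u'(3) v'(3) in \<open>auto simp: compose_def\<close>)
  show "a \<in> A \<Longrightarrow> set_fun (Comp (set_cat U) v u) a = set_fun v (set_fun u a)"
    unfolding eq by (simp add: set_fun_def compose_def)
qed

text \<open>The counterpart of \<open>concrete_is_colimit\<close> for sets: the mediating function
  is computed on any representative, which exists by \<open>surj\<close> and is irrelevant up to
  equality of values by \<open>inj\<close>.\<close>

lemma set_cat_directed_colimitI:
  fixes F :: "('i, 'i \<times> 'i, 's set, 's set \<times> ('s \<Rightarrow> 's) \<times> 's set) functor_map"
  assumes r_P: "\<And>i j. (i, j) \<in> r \<Longrightarrow> i \<in> P \<and> j \<in> P"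
    and directed: "\<And>i j. i \<in> P \<Longrightarrow> j \<in> P \<Longrightarrow> \<exists>k. (i, k) \<in> r \<and> (j, k) \<in> r"
    and F: "\<And>i j. (i, j) \<in> r \<Longrightarrow> ArrMap F (i, j) \<in> hom (set_cat U) (ObjMap F i) (ObjMap F j)"
    and cocone: "is_cocone (poset_cat P r) (set_cat U) F B s"
    and surj: "\<And>b. b \<in> B \<Longrightarrow> \<exists>i\<in>P. \<exists>a\<in>ObjMap F i. set_fun (s i) a = b"
    and inj: "\<And>i a a'. i \<in> P \<Longrightarrow> a \<in> ObjMap F i \<Longrightarrow> a' \<in> ObjMap F i \<Longrightarrow> set_fun (s i) a = set_fun (s i) a' \<Longrightarrow>
      \<exists>j. (i, j) \<in> r \<and> set_fun (ArrMap F (i, j)) a = set_fun (ArrMap F (i, j)) a'"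
  shows "is_colimit (poset_cat P r) (set_cat U) F B s"
  unfolding is_colimit_def
proof (intro conjI cocone allI impI)
  fix B' s' assume cocone': "is_cocone (poset_cat P r) (set_cat U) F B' s'"
  have hom: "t i \<in> hom (set_cat U) (ObjMap F i) C"
    if "is_cocone (poset_cat P r) (set_cat U) F C t" "i \<in> P" for C t i
    using that by (simp add: is_cocone_def poset_cat_def)
  have step: "set_fun (t j) (set_fun (ArrMap F (i, j)) a) = set_fun (t i) a"
    if t: "is_cocone (poset_cat P r) (set_cat U) F C t" and ij: "(i, j) \<in> r" and a: "a \<in> ObjMap F i"
    for C t i j a
  proof -
    have "\<forall>u\<in>r. Comp (set_cat U) (t (snd u)) (ArrMap F u) = t (fst u)"
      using t by (simp add: is_cocone_def poset_cat_def)
    then have "Comp (set_cat U) (t j) (ArrMap F (i, j)) = t i" using ij by force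
    then show ?thesis using Comp_set_cat(2)[OF F[OF ij] hom[OF t] a] r_P[OF ij] by simp
  qed
  have F_in: "set_fun (ArrMap F (i, j)) a \<in> ObjMap F j" if "(i, j) \<in> r" "a \<in> ObjMap F i" for i j a
    using hom_set_catD(3)[OF F[OF that(1)]] that(2) by blast
  have unique: "set_fun (s' i) a = set_fun (s' j) b"
    if i: "i \<in> P" "a \<in> ObjMap F i" and j: "j \<in> P" "b \<in> ObjMap F j" and eq: "set_fun (s i) a = set_fun (s j) b"
    for i j a b
  proof -
    obtain k where k: "(i, k) \<in> r" "(j, k) \<in> r" using directed[OF i(1) j(1)] by blast
    let ?a = "set_fun (ArrMap F (i, k)) a" and ?b = "set_fun (ArrMap F (j, k)) b"
    have ab: "?a \<in> ObjMap F k" "?b \<in> ObjMap F k" using F_in k i j by auto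
    have "set_fun (s k) ?a = set_fun (s k) ?b"
      using step[OF cocone k(1) i(2)] step[OF cocone k(2) j(2)] eq by simp
    then obtain l where l: "(k, l) \<in> r" "set_fun (ArrMap F (k, l)) ?a = set_fun (ArrMap F (k, l)) ?b"
      using inj[OF _ ab] r_P[OF k(1)] by blast
    have "set_fun (s' i) a = set_fun (s' l) (set_fun (ArrMap F (k, l)) ?a)"
      using step[OF cocone' k(1) i(2)] step[OF cocone' l(1) ab(1)] by simp
    also have "\<dots> = set_fun (s' j) b"
      using step[OF cocone' k(2) j(2)] step[OF cocone' l(1) ab(2)] l(2) by simp
    finally show ?thesis .
  qed
  define f where "f = (\<lambda>b\<in>B. SOME y. \<exists>i\<in>P. \<exists>a\<in>ObjMap F i. set_fun (s i) a = b \<and> y = set_fun (s' i) a)"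
  have s_in: "set_fun (s i) a \<in> B" if "i \<in> P" "a \<in> ObjMap F i" for i a
    using hom_set_catD(3)[OF hom[OF cocone that(1)]] that(2) by blast
  have f: "f (set_fun (s i) a) = set_fun (s' i) a" if i: "i \<in> P" "a \<in> ObjMap F i" for i a
  proof -
    have "f (set_fun (s i) a) =
        (SOME y. \<exists>j\<in>P. \<exists>b\<in>ObjMap F j. set_fun (s j) b = set_fun (s i) a \<and> y = set_fun (s' j) b)"
      using s_in[OF i] by (simp add: f_def)
    also have "\<dots> = set_fun (s' i) a"
    proof (rule some_equality)
      show "\<exists>j\<in>P. \<exists>b\<in>ObjMap F j. set_fun (s j) b = set_fun (s i) a \<and> set_fun (s' i) a = set_fun (s' j) b"
        using i by blast
      fix y assume "\<exists>j\<in>P. \<exists>b\<in>ObjMap F j. set_fun (s j) b = set_fun (s i) a \<and> y = set_fun (s' j) b"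
      then obtain j b where j: "j \<in> P" "b \<in> ObjMap F j" "set_fun (s j) b = set_fun (s i) a"
        and y: "y = set_fun (s' j) b" by blast
      show "y = set_fun (s' i) a" unfolding y by (rule unique[OF j(1,2) i j(3)])
    qed
    finally show ?thesis .
  qed
  have B: "small U B" "small U B'"
    using cocone cocone' by (simp_all add: is_cocone_def set_cat_def)
  have f_in: "f \<in> B \<rightarrow>\<^sub>E B'"
  proof (rule PiE_I)
    fix b assume "b \<in> B"
    then obtain i a where i: "i \<in> P" "a \<in> ObjMap F i" "b = set_fun (s i) a" using surj by blast
    then show "f b \<in> B'" using f[OF i(1,2)] hom_set_catD(3)[OF hom[OF cocone' i(1)]] by auto
  qed (simp add: f_def)
  define h where "h = (B, f, B')"
  have h: "h \<in> hom (set_cat U) B B'" unfolding h_def by (rule hom_set_catI[OF B f_in])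
  have h_fun: "set_fun h = f" by (simp add: h_def set_fun_def)
  have "\<exists>!h. h \<in> hom (set_cat U) B B' \<and> (\<forall>i\<in>P. Comp (set_cat U) h (s i) = s' i)"
  proof (rule ex1I[of _ h], intro conjI ballI h)
    fix i assume i: "i \<in> P"
    show "Comp (set_cat U) h (s i) = s' i"
      by (rule set_cat_eqI[OF Comp_set_cat(1)[OF hom[OF cocone i] h] hom[OF cocone' i]])
        (simp add: Comp_set_cat(2)[OF hom[OF cocone i] h] h_fun f[OF i])
  next
    fix k assume k: "k \<in> hom (set_cat U) B B' \<and> (\<forall>i\<in>P. Comp (set_cat U) k (s i) = s' i)"
    then have k1: "k \<in> hom (set_cat U) B B'" by blast
    show "k = h"
    proof (rule set_cat_eqI[OF k1 h])
      fix b assume "b \<in> B"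
      then obtain i a where i: "i \<in> P" "a \<in> ObjMap F i" "b = set_fun (s i) a" using surj by blast
      show "set_fun k b = set_fun h b"
        using Comp_set_cat(2)[OF hom[OF cocone i(1)] k1 i(2)] k i f[OF i(1,2)] by (simp add: h_fun)
    qed
  qed
  then show "\<exists>!h. h \<in> hom (set_cat U) B B' \<and>
      (\<forall>i\<in>Obj (poset_cat P r). Comp (set_cat U) h (s i) = s' i)" by (simp add: poset_cat_def)
qed

lemma hom_functor_ArrMap:
  fixes X Y Z :: "('u, 'u, 'v::quantale) ncat"
  assumes U: "universe TYPE('u)" and X: "X \<in> small_ncats" and u: "u \<in> hom Cat_normed Y Z"
  shows "ArrMap (hom_functor TYPE('u) Cat_normed X) u \<in>
      hom (set_cat TYPE('u)) (Inl ` hom Cat_normed X Y) (Inl ` hom Cat_normed X Z)"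
    and "v \<in> hom Cat_normed X Y \<Longrightarrow>
      set_fun (ArrMap (hom_functor TYPE('u) Cat_normed X) u) (Inl v) = Inl (Comp Cat_normed u v)"
proof -
  note YZ = hom_Cat_normedD(1,2)[OF u]
  have dc: "Dom Cat_normed u = Y" "Cod Cat_normed u = Z" using u by (auto simp: hom_def)
  have small: "small TYPE('u) (Inl ` hom Cat_normed X W)" if "W \<in> small_ncats" for W
    using locally_small_Cat_normed[OF U, where 'v='v] X that
    unfolding locally_small_def by (intro small_image) auto
  have eq: "ArrMap (hom_functor TYPE('u) Cat_normed X) u = (Inl ` hom Cat_normed X Y,
      \<lambda>p\<in>Inl ` hom Cat_normed X Y. Inl (Comp Cat_normed u (projl p)), Inl ` hom Cat_normed X Z)"
    by (simp add: hom_functor_def dc)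
  show "ArrMap (hom_functor TYPE('u) Cat_normed X) u \<in>
      hom (set_cat TYPE('u)) (Inl ` hom Cat_normed X Y) (Inl ` hom Cat_normed X Z)"
    unfolding eq
    by (rule hom_set_catI[OF small[OF YZ(1)] small[OF YZ(2)]]) (auto intro!: imageI Comp_Cat_normed(2) u)
  show "v \<in> hom Cat_normed X Y \<Longrightarrow>
      set_fun (ArrMap (hom_functor TYPE('u) Cat_normed X) u) (Inl v) = Inl (Comp Cat_normed u v)"
    unfolding eq by (simp add: set_fun_def)
qed

section \<open>Factorization through the stages of a directed colimit\<close>

context directed_diagram
begin

lemma P_nonempty: obtains i where "i \<in> P"
  using bound[of "{}"] by (auto simp: card_of_empty)

text \<open>Each single equation holds at some later stage by separation and persists from there;
  \<open>family_bound\<close> collects them.\<close>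

lemma equations_bound:
  assumes s: "separating s" and i: "i \<in> P" and Z: "|Z| \<le>o |K|"
    and eq: "\<And>f g. (f, g) \<in> Z \<Longrightarrow> f \<in> Arr (E i) \<and> g \<in> Arr (E i) \<and> s i f = s i g"
  obtains j where "(i, j) \<in> r" "\<And>f g. (f, g) \<in> Z \<Longrightarrow> M i j f = M i j g"
proof (rule family_bound[OF Z i, where Q = "\<lambda>z j. M i j (fst z) = M i j (snd z)"])
  fix z assume "z \<in> Z"
  then show "\<exists>j. (i, j) \<in> r \<and> M i j (fst z) = M i j (snd z)"
    using s eq[of "fst z" "snd z"] i unfolding separating_def by auto
next
  fix z j k assume z: "z \<in> Z" and ij: "(i, j) \<in> r" and jk: "(j, k) \<in> r"
    and e: "M i j (fst z) = M i j (snd z)"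
  have "fst z \<in> Arr (E i)" "snd z \<in> Arr (E i)" using eq[of "fst z" "snd z"] z by auto
  then show "M i k (fst z) = M i k (snd z)"
    using e M_Comp[OF ij jk, of "fst z"] M_Comp[OF ij jk, of "snd z"] by simp
next
  fix j assume "(i, j) \<in> r" "\<And>z. z \<in> Z \<Longrightarrow> M i j (fst z) = M i j (snd z)"
  then show thesis using that by fastforce
qed

text \<open>Because norms are attained, all arrows of \<open>X\<close> can be lifted to one stage
  without loss of norm, though not functorially. Each functor law holds in the colimit, hence at a
  later stage, and there are at most \<open>|K|\<close> laws.\<close>

lemma factor_through:
  assumes ct: "concrete c t" and X: "|Arr X| \<le>o |K|" and u: "u \<in> hom Cat_normed X c"
  obtains i v where "i \<in> P" "v \<in> hom Cat_normed X (E i)" "Comp Cat_normed (t i) v = u"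
proof -
  have cocone: "is_cocone (poset_cat P r) Cat_normed D c t" and sep: "separating (\<lambda>i. arrmap (t i))"
    and surj: "\<And>p. p \<in> Arr c \<Longrightarrow> \<exists>i \<in> P. \<exists>f \<in> Arr (E i). arrmap (t i) f = p \<and> nrm c p \<le> nrm (E i) f"
    using ct unfolding concrete_def by blast+
  note t = cocone_hom(2,3)[OF cocone] and comp = compatibleD[OF separating_compatible[OF sep]]
  note u' = hom_Cat_normedD(3)[OF u] and X_small = hom_Cat_normedD(1)[OF u]
  interpret X: category X by (rule small_ncatsD(2)[OF X_small])
  have img: "|g ` A| \<le>o |K|" if "|A| \<le>o |K|" for g :: "'x \<Rightarrow> 'y" and A
    by (rule ordLeq_transitive[OF card_of_image that])
  obtain i0 where i0: "i0 \<in> P" using P_nonempty .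
  obtain i where i: "(i0, i) \<in> r"
    and ex: "\<And>x. x \<in> Arr X \<Longrightarrow> \<exists>f\<in>Arr (E i). arrmap (t i) f = arrmap u x \<and> nrm X x \<le> nrm (E i) f"
  proof (rule family_bound[OF X i0,
        where Q = "\<lambda>x i. \<exists>f\<in>Arr (E i). arrmap (t i) f = arrmap u x \<and> nrm X x \<le> nrm (E i) f"])
    fix x assume x: "x \<in> Arr X"
    obtain j f where j: "j \<in> P" "f \<in> Arr (E j)" "arrmap (t j) f = arrmap u x" "nrm c (arrmap u x) \<le> nrm (E j) f"
      using surj[OF arrfunD(1)[OF u' x]] by blast
    obtain k where k: "(i0, k) \<in> r" "(j, k) \<in> r" using finite_bound[OF i0 j(1)] .
    have "nrm X x \<le> nrm (E k) (M j k f)"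
      using arrfunD(2)[OF u' x] j(4) arrfunD(2)[OF M_arrfun[OF k(2)] j(2)] by (meson order_trans)
    then show "\<exists>k. (i0, k) \<in> r \<and>
        (\<exists>f\<in>Arr (E k). arrmap (t k) f = arrmap u x \<and> nrm X x \<le> nrm (E k) f)"
      using k(1) M_arr[OF k(2) j(2)] comp[OF k(2) j(2)] j(3) by auto
  next
    fix x j k assume jk: "(j, k) \<in> r"
      and "\<exists>f\<in>Arr (E j). arrmap (t j) f = arrmap u x \<and> nrm X x \<le> nrm (E j) f"
    then obtain f where f: "f \<in> Arr (E j)" "arrmap (t j) f = arrmap u x" "nrm X x \<le> nrm (E j) f" by blast
    then show "\<exists>f\<in>Arr (E k). arrmap (t k) f = arrmap u x \<and> nrm X x \<le> nrm (E k) f"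
      using M_arr[OF jk f(1)] comp[OF jk f(1)] order_trans[OF f(3) arrfunD(2)[OF M_arrfun[OF jk] f(1)]]
      by auto
  qed blast
  have iP: "i \<in> P" using r_P(2)[OF i] .
  interpret Ei: category "E i" using E_cat[OF iP] .
  obtain a where a: "\<And>x. x \<in> Arr X \<Longrightarrow> a x \<in> Arr (E i)"
      "\<And>x. x \<in> Arr X \<Longrightarrow> arrmap (t i) (a x) = arrmap u x" "\<And>x. x \<in> Arr X \<Longrightarrow> nrm X x \<le> nrm (E i) (a x)"
    using ex by metis
  \<comment> \<open>The laws on identities and ends. Both sides have the same image in
    \<open>c\<close> because \<open>u\<close> and \<open>t i\<close> are functors.\<close>
  define Z1 where "Z1 = (\<lambda>x. (a (Id X (Dom X x)), Id (E i) (Dom (E i) (a x)))) ` Arr X \<union>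
      (\<lambda>x. (a (Id X (Cod X x)), Id (E i) (Cod (E i) (a x)))) ` Arr X"
  have "|Z1| \<le>o |K|"
    unfolding Z1_def using K_inf img[OF X]
    by (intro card_of_Un_ordLeq_infinite_Field) (auto simp: Field_card_of card_of_card_order_on)
  moreover have "f \<in> Arr (E i) \<and> g \<in> Arr (E i) \<and> arrmap (t i) f = arrmap (t i) g" if z: "(f, g) \<in> Z1" for f g
  proof -
    obtain x where x: "x \<in> Arr X" and fg: "f = a (Id X (Dom X x)) \<and> g = Id (E i) (Dom (E i) (a x)) \<or>
        f = a (Id X (Cod X x)) \<and> g = Id (E i) (Cod (E i) (a x))"
      using z unfolding Z1_def by blast
    show ?thesis
      using fg a(1)[OF x] a(1)[of "Id X (Dom X x)"] a(1)[of "Id X (Cod X x)"] a(2)[OF x]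
        a(2)[of "Id X (Dom X x)"] a(2)[of "Id X (Cod X x)"] x arrfunD(3,4)[OF u' x]
        arrfunD(3,4)[OF t(2)[OF iP] a(1)[OF x]] by auto
  qed
  ultimately obtain j where ij: "(i, j) \<in> r" and Z1: "\<And>f g. (f, g) \<in> Z1 \<Longrightarrow> M i j f = M i j g"
    using equations_bound[OF sep iP] by blast
  have jP: "j \<in> P" using r_P(2)[OF ij] .
  interpret Ej: category "E j" using E_cat[OF jP] .
  define b where "b x = M i j (a x)" for x
  have b: "b x \<in> Arr (E j)" "arrmap (t j) (b x) = arrmap u x" "nrm X x \<le> nrm (E j) (b x)"
      "b (Id X (Dom X x)) = Id (E j) (Dom (E j) (b x))" "b (Id X (Cod X x)) = Id (E j) (Cod (E j) (b x))"
    if x: "x \<in> Arr X" for x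
  proof -
    note Ma = arrfunD[OF M_arrfun[OF ij] a(1)[OF x]]
    show "b x \<in> Arr (E j)" "arrmap (t j) (b x) = arrmap u x" "nrm X x \<le> nrm (E j) (b x)"
      using Ma comp[OF ij a(1)[OF x]] a(2)[OF x] order_trans[OF a(3)[OF x] Ma(2)] by (simp_all add: b_def)
    have "(a (Id X (Dom X x)), Id (E i) (Dom (E i) (a x))) \<in> Z1"
      "(a (Id X (Cod X x)), Id (E i) (Cod (E i) (a x))) \<in> Z1" unfolding Z1_def using x by blast+
    from this[THEN Z1] show "b (Id X (Dom X x)) = Id (E j) (Dom (E j) (b x))"
      "b (Id X (Cod X x)) = Id (E j) (Cod (E j) (b x))"
      using Ma(3,4) by (simp_all add: b_def)
  qed
  have bc: "Cod (E j) (b x) = Dom (E j) (b y)" if "x \<in> Arr X" "y \<in> Arr X" "Cod X x = Dom X y" for x y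
  proof -
    have "Id (E j) (Cod (E j) (b x)) = Id (E j) (Dom (E j) (b y))"
      using b(5)[OF that(1)] b(4)[OF that(2)] that(3) by simp
    then show ?thesis using Ej.Id_eq_iff b(1)[OF that(1)] b(1)[OF that(2)] by simp
  qed
  \<comment> \<open>Only now do composites of lifted arrows make sense, since matching ends come
    from \<open>Z1\<close>; hence a second passage to a later stage for the laws on
    composition.\<close>
  define C where "C = {(x, y). x \<in> Arr X \<and> y \<in> Arr X \<and> Cod X x = Dom X y}"
  define Z2 where "Z2 = (\<lambda>(x, y). (b (Comp X y x), Comp (E j) (b y) (b x))) ` C"
  have "|C| \<le>o |Arr X \<times> Arr X|" by (rule card_of_mono1) (auto simp: C_def)
  moreover have "|Arr X \<times> Arr X| \<le>o |K|" using X K_inf by (simp add: card_of_Sigma_ordLeq_infinite)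
  ultimately have "|C| \<le>o |K|" by (rule ordLeq_transitive)
  then have "|Z2| \<le>o |K|" unfolding Z2_def by (rule img)
  moreover have "f \<in> Arr (E j) \<and> g \<in> Arr (E j) \<and> arrmap (t j) f = arrmap (t j) g" if z: "(f, g) \<in> Z2" for f g
  proof -
    obtain x y where x: "x \<in> Arr X" and y: "y \<in> Arr X" and xy: "Cod X x = Dom X y"
      and f: "f = b (Comp X y x)" and g: "g = Comp (E j) (b y) (b x)"
      using z by (auto simp: Z2_def C_def)
    have "arrmap (t j) f = Comp c (arrmap u y) (arrmap u x)"
      using b(2)[OF X.Comp_simps(1)[OF x y xy]] arrfun_Comp[OF u' x y xy] by (simp add: f)
    moreover have "arrmap (t j) g = Comp c (arrmap u y) (arrmap u x)"
      using arrfun_Comp[OF t(2)[OF jP] b(1)[OF x] b(1)[OF y] bc[OF x y xy]] b(2)[OF x] b(2)[OF y]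
      by (simp add: g)
    ultimately show ?thesis
      using b(1)[OF X.Comp_simps(1)[OF x y xy]] Ej.Comp_simps(1)[OF b(1)[OF x] b(1)[OF y] bc[OF x y xy]]
      by (simp add: f g)
  qed
  ultimately obtain k where jk: "(j, k) \<in> r" and Z2: "\<And>f g. (f, g) \<in> Z2 \<Longrightarrow> M j k f = M j k g"
    using equations_bound[OF sep jP] by blast
  have kP: "k \<in> P" using r_P(2)[OF jk] .
  have d: "arrfun X (E k) (M j k \<circ> b)"
  proof (rule arrfunI)
    fix x assume x: "x \<in> Arr X"
    note Mb = arrfunD[OF M_arrfun[OF jk] b(1)[OF x]]
    show "(M j k \<circ> b) x \<in> Arr (E k)" "nrm X x \<le> nrm (E k) ((M j k \<circ> b) x)"
      "(M j k \<circ> b) (Id X (Dom X x)) = Id (E k) (Dom (E k) ((M j k \<circ> b) x))"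
      "(M j k \<circ> b) (Id X (Cod X x)) = Id (E k) (Cod (E k) ((M j k \<circ> b) x))"
      using Mb b(4,5)[OF x] order_trans[OF b(3)[OF x] Mb(2)] by simp_all
    fix y assume y: "y \<in> Arr X" "Cod X x = Dom X y"
    have "(x, y) \<in> C" using x y by (simp add: C_def)
    then have "(b (Comp X y x), Comp (E j) (b y) (b x)) \<in> Z2" unfolding Z2_def by force
    from Z2[OF this] show "(M j k \<circ> b) (Comp X y x) = Comp (E k) ((M j k \<circ> b) y) ((M j k \<circ> b) x)"
      using arrfun_Comp[OF M_arrfun[OF jk] b(1)[OF x] b(1)[OF y(1)] bc[OF x y]] by simp
  qed
  define v where "v = arrow_of X (M j k \<circ> b) (E k)"
  have v: "v \<in> hom Cat_normed X (E k)"
    unfolding v_def by (rule hom_Cat_normedI[OF X_small E_small[OF kP] d])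
  have "Comp Cat_normed (t k) v = u"
  proof (rule Cat_normed_eqI[OF Comp_Cat_normed(2)[OF v t(1)[OF kP]] u])
    fix x assume x: "x \<in> Arr X"
    have "arrmap v x = M j k (b x)" unfolding v_def by (simp add: arrmap_arrow_of x)
    then show "arrmap (Comp Cat_normed (t k) v) x = arrmap u x"
      using Comp_Cat_normed(3)[OF v t(1)[OF kP] x] comp[OF jk b(1)[OF x]] b(2)[OF x] by simp
  qed
  then show ?thesis using that[OF kP v] by blast
qed

text \<open>There is one equation for each arrow of \<open>X\<close>, and equality of the two
  composites makes all of them true in the colimit.\<close>

lemma factor_unique:
  assumes ct: "concrete c t" and X: "|Arr X| \<le>o |K|" and i: "i \<in> P"
    and v: "v \<in> hom Cat_normed X (E i)" and w: "w \<in> hom Cat_normed X (E i)"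
    and eq: "Comp Cat_normed (t i) v = Comp Cat_normed (t i) w"
  obtains j where "(i, j) \<in> r" "Comp Cat_normed (ArrMap D (i, j)) v = Comp Cat_normed (ArrMap D (i, j)) w"
proof -
  have cocone: "is_cocone (poset_cat P r) Cat_normed D c t" and sep: "separating (\<lambda>i. arrmap (t i))"
    using ct unfolding concrete_def by blast+
  note t = cocone_hom(2)[OF cocone i]
  define Z where "Z = (\<lambda>x. (arrmap v x, arrmap w x)) ` Arr X"
  have "|Z| \<le>o |K|" unfolding Z_def by (rule ordLeq_transitive[OF card_of_image X])
  moreover have "f \<in> Arr (E i) \<and> g \<in> Arr (E i) \<and> arrmap (t i) f = arrmap (t i) g" if "(f, g) \<in> Z" for f g
  proof -
    obtain x where x: "x \<in> Arr X" "f = arrmap v x" "g = arrmap w x" using \<open>(f, g) \<in> Z\<close> unfolding Z_def by blast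
    show ?thesis
      using arrfunD(1)[OF hom_Cat_normedD(3)[OF v] x(1)] arrfunD(1)[OF hom_Cat_normedD(3)[OF w] x(1)]
        Comp_Cat_normed(3)[OF v t x(1)] Comp_Cat_normed(3)[OF w t x(1)] eq x by simp
  qed
  ultimately obtain j where j: "(i, j) \<in> r" and Z: "\<And>f g. (f, g) \<in> Z \<Longrightarrow> M i j f = M i j g"
    using equations_bound[OF sep i] by blast
  have "Comp Cat_normed (ArrMap D (i, j)) v = Comp Cat_normed (ArrMap D (i, j)) w"
  proof (rule Cat_normed_eqI[OF Comp_Cat_normed(2)[OF v M_hom[OF j]] Comp_Cat_normed(2)[OF w M_hom[OF j]]])
    fix x assume x: "x \<in> Arr X"
    then show "arrmap (Comp Cat_normed (ArrMap D (i, j)) v) x = arrmap (Comp Cat_normed (ArrMap D (i, j)) w) x"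
      using Z[of "arrmap v x" "arrmap w x"] Comp_Cat_normed(3)[OF v M_hom[OF j] x]
        Comp_Cat_normed(3)[OF w M_hom[OF j] x] unfolding Z_def by auto
  qed
  then show ?thesis using that[OF j] by blast
qed

text \<open>For the hom-sets out of \<open>X\<close>, \<open>factor_through\<close> is joint
  surjectivity and \<open>factor_unique\<close> is eventual equality.\<close>

lemma hom_functor_colimit:
  assumes U: "universe TYPE('u)" and P: "small TYPE('u) P"
    and X: "X \<in> small_ncats" and card_X: "|Arr X| \<le>o |K|"
    and ct: "is_colimit (poset_cat P r) Cat_normed D c t"
  shows "is_colimit (poset_cat P r) (set_cat TYPE('u)) (functor_comp (hom_functor TYPE('u) Cat_normed X) D)
    (ObjMap (hom_functor TYPE('u) Cat_normed X) c) (\<lambda>i. ArrMap (hom_functor TYPE('u) Cat_normed X) (t i))"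
proof -
  let ?H = "hom_functor TYPE('u) Cat_normed X"
  note con = colimit_concrete[OF U P ct]
  have cocone: "is_cocone (poset_cat P r) Cat_normed D c t" using con unfolding concrete_def by blast
  note t = cocone_hom(2)[OF cocone]
  note H = hom_functor_ArrMap[OF U X]
  have obj: "ObjMap (functor_comp ?H D) i = Inl ` hom Cat_normed X (E i)"
    "ArrMap (functor_comp ?H D) z = ArrMap ?H (ArrMap D z)" "ObjMap ?H c = Inl ` hom Cat_normed X c" for i z
    by (simp_all add: functor_comp_def hom_functor_def)
  show ?thesis
  proof (rule set_cat_directed_colimitI)
    show "\<And>i j. (i, j) \<in> r \<Longrightarrow> i \<in> P \<and> j \<in> P" using r_P by blast
    show "\<exists>k. (i, k) \<in> r \<and> (j, k) \<in> r" if "i \<in> P" "j \<in> P" for i j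
      by (rule finite_bound[OF that]) blast
    show FH: "ArrMap (functor_comp ?H D) (i, j) \<in>
        hom (set_cat TYPE('u)) (ObjMap (functor_comp ?H D) i) (ObjMap (functor_comp ?H D) j)"
      if "(i, j) \<in> r" for i j
      unfolding obj by (rule H(1)[OF M_hom[OF that]])
    have tH: "ArrMap ?H (t i) \<in> hom (set_cat TYPE('u)) (ObjMap (functor_comp ?H D) i) (ObjMap ?H c)"
      if "i \<in> P" for i
      unfolding obj by (rule H(1)[OF t[OF that]])
    have "Comp (set_cat TYPE('u)) (ArrMap ?H (t j)) (ArrMap (functor_comp ?H D) (i, j)) = ArrMap ?H (t i)"
      if ij: "(i, j) \<in> r" for i j
    proof (rule set_cat_eqI[OF Comp_set_cat(1)[OF FH[OF ij] tH[OF r_P(2)[OF ij]]] tH[OF r_P(1)[OF ij]]])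
      fix a assume a: "a \<in> ObjMap (functor_comp ?H D) i"
      then obtain v where v: "v \<in> hom Cat_normed X (E i)" "a = Inl v" unfolding obj by blast
      have "Comp Cat_normed (t j) (ArrMap D (i, j)) = t i"
        using is_cocone_Cat_normedD(3)[OF cocone, of "(i, j)"] ij by (simp add: poset_cat_def)
      then show "set_fun (Comp (set_cat TYPE('u)) (ArrMap ?H (t j)) (ArrMap (functor_comp ?H D) (i, j))) a =
          set_fun (ArrMap ?H (t i)) a"
        using Comp_set_cat(2)[OF FH[OF ij] tH[OF r_P(2)[OF ij]] a] H(2)[OF M_hom[OF ij] v(1)]
          H(2)[OF t[OF r_P(2)[OF ij]] Comp_Cat_normed(2)[OF v(1) M_hom[OF ij]]] H(2)[OF t[OF r_P(1)[OF ij]] v(1)]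
          category.Comp_assoc[OF category_Cat_normed v(1) M_hom[OF ij] t[OF r_P(2)[OF ij]]]
        by (simp add: obj v(2))
    qed
    moreover have "ObjMap ?H c \<in> Obj (set_cat TYPE('u))"
    proof -
      \<comment> \<open>Smallness of the hom-set into \<open>c\<close> is read off from a leg; one
        exists because directed posets are nonempty.\<close>
      obtain i where i: "i \<in> P" using P_nonempty .
      show ?thesis using hom_set_catD(2)[OF tH[OF i]] by (simp add: set_cat_def)
    qed
    ultimately show "is_cocone (poset_cat P r) (set_cat TYPE('u)) (functor_comp ?H D) (ObjMap ?H c)
        (\<lambda>i. ArrMap ?H (t i))"
      unfolding is_cocone_def using tH by (auto simp: poset_cat_def)
    fix b assume "b \<in> ObjMap ?H c"
    then obtain u where u: "u \<in> hom Cat_normed X c" "b = Inl u" unfolding obj by blast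
    obtain i v where i: "i \<in> P" and v: "v \<in> hom Cat_normed X (E i)" "Comp Cat_normed (t i) v = u"
      using factor_through[OF con card_X u(1)] .
    show "\<exists>i\<in>P. \<exists>a\<in>ObjMap (functor_comp ?H D) i. set_fun (ArrMap ?H (t i)) a = b"
      using i v H(2)[OF t[OF i] v(1)] unfolding obj u(2) by auto
  next
    fix i a a' assume i: "i \<in> P" and a: "a \<in> ObjMap (functor_comp ?H D) i" "a' \<in> ObjMap (functor_comp ?H D) i"
      and eq: "set_fun (ArrMap ?H (t i)) a = set_fun (ArrMap ?H (t i)) a'"
    obtain v w where v: "v \<in> hom Cat_normed X (E i)" "a = Inl v" and w: "w \<in> hom Cat_normed X (E i)" "a' = Inl w"
      using a unfolding obj by blast
    have "Comp Cat_normed (t i) v = Comp Cat_normed (t i) w"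
      using eq H(2)[OF t[OF i] v(1)] H(2)[OF t[OF i] w(1)] v(2) w(2) by simp
    then obtain j where j: "(i, j) \<in> r"
        "Comp Cat_normed (ArrMap D (i, j)) v = Comp Cat_normed (ArrMap D (i, j)) w"
      using factor_unique[OF con card_X i v(1) w(1)] by blast
    show "\<exists>j. (i, j) \<in> r \<and> set_fun (ArrMap (functor_comp ?H D) (i, j)) a =
        set_fun (ArrMap (functor_comp ?H D) (i, j)) a'"
      using j H(2)[OF M_hom[OF j(1)] v(1)] H(2)[OF M_hom[OF j(1)] w(1)] unfolding obj v(2) w(2) by auto
  qed
qed

end

lemma directed_diagramI:
  fixes D :: "('i, 'i \<times> 'i, ('u, 'u, 'v::quantale) ncat,
      ('u, 'u, 'v) ncat \<times> ('u, 'u, 'u, 'u) functor_map \<times> ('u, 'u, 'v) ncat) functor_map"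
  assumes lam: "lam =o cardSuc |K|" and K: "infinite K" "|UNIV :: 'v set| \<le>o |K|"
    and P: "directed_poset lam P r" and D: "is_functor (poset_cat P r) Cat_normed D"
  shows "directed_diagram P r D K"
  by (intro directed_diagram.intro diagram.intro directed_diagram_axioms.intro D K)
    (use P card_less_cardSuc_iff[OF lam] in \<open>auto simp: directed_poset_def\<close>)

lemma presentable_objectI:
  fixes X :: "('u, 'u, 'v::quantale) ncat"
  assumes U: "universe TYPE('u)"
    and lam: "lam =o cardSuc |K|" and K: "infinite K" "|UNIV :: 'v set| \<le>o |K|"
    and X: "X \<in> small_ncats" "|Arr X| \<le>o |K|"
  shows "presentable_object TYPE('u) lam Cat_normed X"
  unfolding presentable_object_def preserves_directed_colimits_def
  using X(1) directed_diagram.hom_functor_colimit[OF directed_diagramI[OF lam K] U _ X] by auto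

section \<open>Generators\<close>

lemma graph_eqD: "(\<lambda>x. (x, p x)) ` A = (\<lambda>x. (x, q x)) ` A \<Longrightarrow> x \<in> A \<Longrightarrow> p x = q x"
  by (metis (no_types, lifting) Pair_inject image_iff)

text \<open>The carriers and the graphs of the operations determine \<open>X\<close>, since
  extensionality fixes all other values. Confining the carriers to \<open>S\<close> matters: the
  isomorphic copies of a single nonempty category inside \<open>'u\<close> are already too many to
  be small.\<close>

lemma small_ncats_on:
  fixes S :: "'u set"
  assumes U: "universe TYPE('u)" and S: "small TYPE('u) S" and V: "small TYPE('u) (UNIV :: 'v::quantale set)"
  shows "small TYPE('u) {X :: ('u, 'u, 'v) ncat. X \<in> small_ncats \<and> Obj X \<subseteq> S \<and> Arr X \<subseteq> S}"
    (is "small _ ?G")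
proof -
  define code where "code X = (Obj X, Arr X, (\<lambda>f. (f, Dom X f)) ` Arr X, (\<lambda>f. (f, Cod X f)) ` Arr X,
      (\<lambda>x. (x, Id X x)) ` Obj X,
      (\<lambda>z. (z, Comp X (snd z) (fst z))) ` {(f, g). f \<in> Arr X \<and> g \<in> Arr X \<and> Cod X f = Dom X g},
      (\<lambda>f. (f, nrm X f)) ` Arr X)" for X :: "('u, 'u, 'v) ncat"
  show ?thesis
  proof (rule small_inj)
    show "small TYPE('u) (Pow S \<times> Pow S \<times> Pow (S \<times> S) \<times> Pow (S \<times> S) \<times> Pow (S \<times> S) \<times>
        Pow ((S \<times> S) \<times> S) \<times> Pow (S \<times> (UNIV :: 'v set)))"
      by (intro small_Times small_Pow U S V)
    show "code ` ?G \<subseteq> Pow S \<times> Pow S \<times> Pow (S \<times> S) \<times> Pow (S \<times> S) \<times> Pow (S \<times> S) \<times>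
        Pow ((S \<times> S) \<times> S) \<times> Pow (S \<times> (UNIV :: 'v set))"
    proof (rule image_subsetI)
      fix X assume "X \<in> ?G"
      then have X: "category X" "Obj X \<subseteq> S" "Arr X \<subseteq> S" using small_ncatsD(2) by auto
      interpret category X by (rule X(1))
      have 1: "Dom X f \<in> S" "Cod X f \<in> S" if "f \<in> Arr X" for f using that X by auto
      have 2: "Id X x \<in> S" if "x \<in> Obj X" for x using Id_simps(1)[OF that] X by auto
      have 3: "Comp X g f \<in> S" if "f \<in> Arr X" "g \<in> Arr X" "Cod X f = Dom X g" for f g
        using Comp_simps(1)[OF that] X by auto
      show "code X \<in> Pow S \<times> Pow S \<times> Pow (S \<times> S) \<times> Pow (S \<times> S) \<times> Pow (S \<times> S) \<times>
          Pow ((S \<times> S) \<times> S) \<times> Pow (S \<times> (UNIV :: 'v set))"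
        unfolding code_def using X 1 2 3 by auto
    qed
    show "inj_on code ?G"
    proof (rule inj_onI)
      fix X Y assume "X \<in> ?G" "Y \<in> ?G" and eq: "code X = code Y"
      then have XY: "extensional_ncat X" "extensional_ncat Y" using small_ncatsD(5) by auto
      have ob: "Obj X = Obj Y" and ar: "Arr X = Arr Y" using eq unfolding code_def by auto
      have 1: "Dom X f = Dom Y f" "Cod X f = Cod Y f" "nrm X f = nrm Y f" if "f \<in> Arr X" for f
        using eq that graph_eqD[of "Dom X" "Arr X" "Dom Y" f] graph_eqD[of "Cod X" "Arr X" "Cod Y" f]
          graph_eqD[of "nrm X" "Arr X" "nrm Y" f] unfolding code_def ar by simp_all
      have 2: "Id X x = Id Y x" if "x \<in> Obj X" for x
        using eq that graph_eqD[of "Id X" "Obj X" "Id Y" x] unfolding code_def ob by simp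
      have D: "Dom X = Dom Y" "Cod X = Cod Y" "nrm X = nrm Y"
        by (rule extensionalityI[of _ "Arr X"]; use XY 1 ar in \<open>simp add: extensional_ncat_def\<close>)+
      have I: "Id X = Id Y"
        by (rule extensionalityI[of _ "Obj X"]; use XY 2 ob in \<open>simp add: extensional_ncat_def\<close>)
      let ?C = "{(f, g). f \<in> Arr X \<and> g \<in> Arr X \<and> Cod X f = Dom X g}"
      have g: "(\<lambda>z. (z, Comp X (snd z) (fst z))) ` ?C = (\<lambda>z. (z, Comp Y (snd z) (fst z))) ` ?C"
        using eq unfolding code_def D ar by simp
      have "Comp X g f = Comp Y g f" for f g
      proof (cases "f \<in> Arr X \<and> g \<in> Arr X \<and> Cod X f = Dom X g")
        case True
        then show ?thesis using graph_eqD[OF g, of "(f, g)"] by simp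
      next
        case False
        then have "Comp X g f = undefined" "Comp Y g f = undefined"
          using XY unfolding extensional_ncat_def ar D by blast+
        then show ?thesis by simp
      qed
      then show "X = Y" using ob ar D I by (intro ncat.equality ext) auto
    qed
  qed
qed

section \<open>Subcategories with at most \<open>|K|\<close> arrows\<close>

text \<open>The image of \<open>K\<close> under \<open>emb0\<close> is one set in \<open>'u\<close>,
  chosen independently of \<open>X\<close>, on which copies of all the subcategories are
  placed.\<close>

locale small_subcats =
  fixes X :: "('u, 'u, 'v::quantale) ncat" and K :: "'k set" and emb0 :: "'k \<Rightarrow> 'u"
  assumes U: "universe TYPE('u)" and X_small: "X \<in> small_ncats"
    and K_inf: "infinite K" and emb0: "inj_on emb0 K"
begin

sublocale normed_category X
  using X_small small_ncatsD(1) by blast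

definition closed_sets where
  "closed_sets = {S. S \<subseteq> Arr X \<and> |S| \<le>o |K| \<and>
     (\<forall>f\<in>S. Id X (Dom X f) \<in> S \<and> Id X (Cod X f) \<in> S) \<and>
     (\<forall>f\<in>S. \<forall>g\<in>S. Cod X f = Dom X g \<longrightarrow> Comp X g f \<in> S)}"

text \<open>Identities are added once, before closing under composition, because a composite has the
  ends of its factors. Neither addition exceeds \<open>|K|\<close>.\<close>

lemma ex_closed_set:
  assumes G: "G \<subseteq> Arr X" "|G| \<le>o |K|"
  shows "\<exists>S\<in>closed_sets. G \<subseteq> S"
proof -
  define G' where "G' = G \<union> ((\<lambda>f. Id X (Dom X f)) ` G \<union> (\<lambda>f. Id X (Cod X f)) ` G)"
  define S where "S = op_closure G' (\<lambda>f g. Cod X f = Dom X g) (Comp X)"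
  have img: "|g ` G| \<le>o |K|" for g :: "'u \<Rightarrow> 'u" by (rule ordLeq_transitive[OF card_of_image G(2)])
  have "|G'| \<le>o |K|"
    unfolding G'_def using K_inf img G(2)
    by (intro card_of_Un_ordLeq_infinite_Field) (auto simp: Field_card_of card_of_card_order_on)
  then have card_S: "|S| \<le>o |K|" unfolding S_def by (rule card_of_op_closure[OF K_inf])
  have "f \<in> Arr X \<and> Id X (Dom X f) \<in> S \<and> Id X (Cod X f) \<in> S" if "f \<in> S" for f
    using that unfolding S_def
  proof induction
    case (gen f)
    then obtain g where g: "g \<in> G" "f = g \<or> f = Id X (Dom X g) \<or> f = Id X (Cod X g)"
      unfolding G'_def by blast
    have gA: "g \<in> Arr X" using g(1) G(1) by blast
    have "Id X (Dom X g) \<in> G'" "Id X (Cod X g) \<in> G'" using g(1) unfolding G'_def by blast+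
    then have "Id X (Dom X f) \<in> G'" "Id X (Cod X f) \<in> G'" using g(2) gA by auto
    then show ?case using g(2) gA by (auto intro: op_closure.gen)
  qed auto
  then have "S \<in> closed_sets"
    using card_S op_closure.op[of _ G' "\<lambda>f g. Cod X f = Dom X g" "Comp X"]
    unfolding closed_sets_def S_def by auto
  moreover have "G \<subseteq> S" unfolding S_def G'_def by (auto intro: op_closure.gen)
  ultimately show ?thesis by blast
qed

text \<open>Its operations keep the values of \<open>X\<close> outside \<open>S\<close>, so it is in
  general not extensional and no object of \<open>Cat_normed\<close>; \<open>copy\<close> repairs
  this.\<close>

definition sub_ncat where "sub_ncat S = X\<lparr>Obj := Dom X ` S, Arr := S\<rparr>"

lemma sub_ncat_simps [simp]:
  "Obj (sub_ncat S) = Dom X ` S" "Arr (sub_ncat S) = S" "Dom (sub_ncat S) = Dom X" "Cod (sub_ncat S) = Cod X"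
  "Id (sub_ncat S) = Id X" "Comp (sub_ncat S) = Comp X" "nrm (sub_ncat S) = nrm X"
  by (simp_all add: sub_ncat_def)

lemma closed_setsD:
  assumes "S \<in> closed_sets"
  shows "f \<in> S \<Longrightarrow> f \<in> Arr X" "|S| \<le>o |K|" "f \<in> S \<Longrightarrow> Id X (Dom X f) \<in> S"
    "f \<in> S \<Longrightarrow> Id X (Cod X f) \<in> S" "f \<in> S \<Longrightarrow> g \<in> S \<Longrightarrow> Cod X f = Dom X g \<Longrightarrow> Comp X g f \<in> S"
  using assms unfolding closed_sets_def by blast+

lemma normed_category_sub_ncat:
  assumes S: "S \<in> closed_sets" shows "normed_category (sub_ncat S)"
proof (rule normed_categoryI)
  note cl = closed_setsD[OF S]
  fix f assume "f \<in> Arr (sub_ncat S)"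
  then have f: "f \<in> S" "f \<in> Arr X" using cl by auto
  have "Cod X f = Dom X (Id X (Cod X f))" using f by simp
  then show "Dom (sub_ncat S) f \<in> Obj (sub_ncat S) \<and> Cod (sub_ncat S) f \<in> Obj (sub_ncat S)"
    using f(1) cl(4) by (simp add: rev_image_eqI)
  show "Comp (sub_ncat S) f (Id (sub_ncat S) (Dom (sub_ncat S) f)) = f \<and>
      Comp (sub_ncat S) (Id (sub_ncat S) (Cod (sub_ncat S) f)) f = f" using f by simp
  fix g assume "g \<in> Arr (sub_ncat S)" "Cod (sub_ncat S) f = Dom (sub_ncat S) g"
  then have g: "g \<in> S" "g \<in> Arr X" "Cod X f = Dom X g" using cl by auto
  show "Comp (sub_ncat S) g f \<in> Arr (sub_ncat S) \<and> Dom (sub_ncat S) (Comp (sub_ncat S) g f) = Dom (sub_ncat S) f \<and>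
      Cod (sub_ncat S) (Comp (sub_ncat S) g f) = Cod (sub_ncat S) g \<and>
      nrm (sub_ncat S) f * nrm (sub_ncat S) g \<le> nrm (sub_ncat S) (Comp (sub_ncat S) g f)"
    using f g cl(5) normed_category_nrm_Comp[OF normed_category_axioms] by simp
  fix h assume "h \<in> Arr (sub_ncat S)" "Cod (sub_ncat S) g = Dom (sub_ncat S) h"
  then have h: "h \<in> Arr X" "Cod X g = Dom X h" using cl by auto
  show "Comp (sub_ncat S) h (Comp (sub_ncat S) g f) = Comp (sub_ncat S) (Comp (sub_ncat S) h g) f"
    using Comp_assoc_arr[OF f(2) g(2) h(1) g(3) h(2)] by simp
next
  fix x assume "x \<in> Obj (sub_ncat S)"
  then obtain f where f: "f \<in> S" "x = Dom X f" by auto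
  then have "x \<in> Obj X" using closed_setsD(1)[OF S] by simp
  then show "Id (sub_ncat S) x \<in> Arr (sub_ncat S) \<and> Dom (sub_ncat S) (Id (sub_ncat S) x) = x \<and>
      Cod (sub_ncat S) (Id (sub_ncat S) x) = x \<and> 1 \<le> nrm (sub_ncat S) (Id (sub_ncat S) x)"
    using f closed_setsD(3)[OF S f(1)] nrm_Id by simp
qed

text \<open>The injections for different \<open>S\<close> are chosen independently of each other, so
  a transition functor has to decode with one and encode with another.\<close>

definition emb where "emb S = (SOME e. inj_on e S \<and> e ` S \<subseteq> emb0 ` K)"

lemma emb:
  assumes "S \<in> closed_sets" shows "inj_on (emb S) S" "emb S ` S \<subseteq> emb0 ` K"
proof -
  obtain g where g: "inj_on g S" "g ` S \<subseteq> K"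
    using closed_setsD(2)[OF assms] card_of_ordLeq by metis
  then have "inj_on (emb0 \<circ> g) S \<and> (emb0 \<circ> g) ` S \<subseteq> emb0 ` K"
    using emb0 by (auto intro: comp_inj_on inj_on_subset)
  then have "inj_on (emb S) S \<and> emb S ` S \<subseteq> emb0 ` K" 
    unfolding emb_def by (rule someI[where P = "\<lambda>e. inj_on e S \<and> e ` S \<subseteq> emb0 ` K"])
  then show "inj_on (emb S) S" "emb S ` S \<subseteq> emb0 ` K" by auto
qed

definition copy where "copy S = transport (sub_ncat S) (emb S)"

context
  fixes S assumes S: "S \<in> closed_sets"
begin

lemma emb_Arr: "inj_on (emb S) (Arr (sub_ncat S))" using emb(1)[OF S] by simp

lemmas transport_sub = normed_category_sub_ncat[OF S] emb_Arr

lemma copy_Arr: "Arr (copy S) = emb S ` S"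
  unfolding copy_def transport_simps(2)[OF transport_sub] by simp

lemma copy_Obj: "Obj (copy S) \<subseteq> emb S ` S"
  unfolding copy_def transport_simps(1)[OF transport_sub] using closed_setsD(3)[OF S] by auto

lemma copy_small: "copy S \<in> small_ncats"
  unfolding copy_def
proof (rule transport_small_ncats[OF transport_sub])
  show "small TYPE('u) (Arr (sub_ncat S))"
    using small_subset[OF small_ncatsD(4)[OF X_small], of S] closed_setsD(1)[OF S] by auto
qed

lemma copy_nrm: "f \<in> S \<Longrightarrow> nrm (copy S) (emb S f) = nrm X f"
  unfolding copy_def using transport_simps(7)[OF transport_sub] by simp

lemma arrfun_copy: "arrfun (sub_ncat S) (copy S) (emb S)"
  unfolding copy_def by (rule arrfun_transport[OF transport_sub])

lemma arrfun_inv_copy: "arrfun (copy S) (sub_ncat S) (inv_into S (emb S))"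
  unfolding copy_def using arrfun_inv_transport[OF transport_sub] by simp

lemma arrfun_copy_incl: "arrfun (copy S) X (inv_into S (emb S))"
proof -
  have "arrfun (sub_ncat S) X (\<lambda>f. f)"
    by (rule arrfunI) (use closed_setsD(1)[OF S] in auto)
  from arrfun_compose[OF small_ncatsD(2)[OF copy_small] normed_category_category[OF transport_sub(1)]
      arrfun_inv_copy this]
  show ?thesis by (simp add: comp_def)
qed

lemma arrfun_copy_mono:
  assumes T: "T \<in> closed_sets" and ST: "S \<subseteq> T"
  shows "arrfun (copy S) (sub_ncat T) (inv_into S (emb S))"
proof -
  have "arrfun (sub_ncat S) (sub_ncat T) (\<lambda>f. f)"
    by (rule arrfunI) (use ST in auto)
  from arrfun_compose[OF small_ncatsD(2)[OF copy_small] normed_category_category[OF transport_sub(1)]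
      arrfun_inv_copy this]
  show ?thesis by (simp add: comp_def)
qed

end

text \<open>The union of at most \<open>|K|\<close> closed sets still has at most \<open>|K|\<close>
  arrows and so lies in a closed set, which gives directedness. The cocone of inclusions is
  concrete: the inclusions are injective, every arrow lies in some closed set, and norms are
  inherited.\<close>

lemma ex_directed_colimit:
  assumes lam: "lam =o cardSuc |K|" and K_values: "|UNIV :: 'v set| \<le>o |K|"
  shows "\<exists>(P :: 'u set) r D t. small TYPE('u) P \<and> directed_poset lam P r \<and>
    is_functor (poset_cat P r) Cat_normed D \<and>
    (\<forall>i\<in>P. ObjMap D i \<in> {Y \<in> small_ncats. Obj Y \<subseteq> emb0 ` K \<and> Arr Y \<subseteq> emb0 ` K}) \<and>
    is_colimit (poset_cat P r) Cat_normed D X t"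
proof -
  have closed_small: "small TYPE('u) closed_sets"
    by (rule small_subset[OF small_Pow[OF U small_ncatsD(4)[OF X_small]]]) (auto simp: closed_sets_def)
  \<comment> \<open>The indices of the diagram must be elements of \<open>'u\<close>, so closed sets
    are replaced by codes.\<close>
  then obtain idx :: "'u set \<Rightarrow> 'u" where idx: "inj_on idx closed_sets"
    using small_ex_inj by blast
  define P where "P = idx ` closed_sets"
  define ar where "ar = inv_into closed_sets idx"
  define r where "r = {(i, j). i \<in> P \<and> j \<in> P \<and> ar i \<subseteq> ar j}"
  have P_small: "small TYPE('u) P" unfolding P_def by (rule small_image[OF closed_small])
  have ar: "ar i \<in> closed_sets" "idx (ar i) = i" if "i \<in> P" for i
    using that unfolding P_def ar_def by (simp_all add: inv_into_into f_inv_into_f)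
  have idx_P: "idx S \<in> P" "ar (idx S) = S" if "S \<in> closed_sets" for S
    using that idx unfolding P_def ar_def by auto
  have po: "partial_order_on P r"
    unfolding partial_order_on_def preorder_on_def r_def
    by (auto simp: refl_on_def trans_def antisym_def) (metis ar(2) subset_antisym)
  have bound: "\<exists>b\<in>P. \<forall>s\<in>T. (s, b) \<in> r" if T: "T \<subseteq> P" "|T| \<le>o |K|" for T
  proof -
    have "(\<Union>i\<in>T. ar i) \<subseteq> Arr X" using T(1) ar(1) closed_setsD(1) by blast
    moreover have "|\<Union>i\<in>T. ar i| \<le>o |K|"
      using T ar(1) closed_setsD(2) by (intro card_of_UNION_ordLeq_infinite[OF K_inf]) auto
    ultimately obtain S where S: "S \<in> closed_sets" "(\<Union>i\<in>T. ar i) \<subseteq> S" using ex_closed_set by blast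
    then have "\<forall>s\<in>T. (s, idx S) \<in> r" unfolding r_def using idx_P[OF S(1)] T(1) by auto
    then show ?thesis using idx_P(1)[OF S(1)] by blast
  qed
  have dir: "directed_poset lam P r"
    unfolding directed_poset_def using po bound card_less_cardSuc_iff[OF lam] by blast
  \<comment> \<open>The transition functors are inclusions of closed sets seen through their two
    encodings.\<close>
  define D where "D = \<lparr>ObjMap = (\<lambda>i. copy (ar i)),
    ArrMap = (\<lambda>(i, j). arrow_of (copy (ar i)) (emb (ar j) \<circ> inv_into (ar i) (emb (ar i))) (copy (ar j)))\<rparr>"
  have arrfun_D: "arrfun (copy S) (copy T) (emb T \<circ> inv_into S (emb S))"
    if S: "S \<in> closed_sets" and T: "T \<in> closed_sets" and ST: "S \<subseteq> T" for S T
    by (rule arrfun_compose[OF small_ncatsD(2)[OF copy_small[OF S]]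
          normed_category_category[OF normed_category_sub_ncat[OF T]] arrfun_copy_mono[OF S T ST] arrfun_copy[OF T]])
  have inv: "inv_into S (emb S) (emb S f) = f" if "S \<in> closed_sets" "f \<in> S" for S f
    using emb(1)[OF that(1)] that(2) by simp
  have cat_P: "category (poset_cat P r)"
  proof
    show "f \<in> hom (poset_cat P r) x y \<Longrightarrow> g \<in> hom (poset_cat P r) y z \<Longrightarrow>
        Comp (poset_cat P r) g f \<in> hom (poset_cat P r) x z" for f g x y z
      using subset_trans[of "ar x" "ar y" "ar z"] by (auto simp: poset_cat_def hom_def r_def)
  qed (auto simp: poset_cat_def hom_def r_def)
  have is_fun: "is_functor (poset_cat P r) Cat_normed D"
  proof (intro is_functor.intro cat_P category_Cat_normed is_functor_axioms.intro)
    fix i assume "i \<in> Obj (poset_cat P r)"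
    then have i: "i \<in> P" by (simp add: poset_cat_def)
    note S = ar(1)[OF i]
    show "ObjMap D i \<in> Obj Cat_normed" using copy_small[OF S] by (simp add: D_def)
    have "arrow_of (copy (ar i)) (emb (ar i) \<circ> inv_into (ar i) (emb (ar i))) (copy (ar i)) =
        arrow_of (copy (ar i)) (\<lambda>f. f) (copy (ar i))"
      by (rule arrow_of_cong[OF small_ncatsD(2)[OF copy_small[OF S]]]) (auto simp: copy_Arr[OF S] inv[OF S])
    then show "ArrMap D (Id (poset_cat P r) i) = Id Cat_normed (ObjMap D i)"
      using Id_Cat_normed[OF small_ncatsD(2)[OF copy_small[OF S]]] by (simp add: D_def poset_cat_def)
  next
    fix u i j assume "u \<in> hom (poset_cat P r) i j"
    then have u: "u = (i, j)" and ij: "i \<in> P" "j \<in> P" "ar i \<subseteq> ar j"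
      by (auto simp: poset_cat_def hom_def r_def)
    note S = ar(1)[OF ij(1)] and T = ar(1)[OF ij(2)]
    show "ArrMap D u \<in> hom Cat_normed (ObjMap D i) (ObjMap D j)"
      unfolding u D_def using hom_Cat_normedI[OF copy_small[OF S] copy_small[OF T] arrfun_D[OF S T ij(3)]] by simp
    fix v k assume "v \<in> hom (poset_cat P r) j k"
    then have v: "v = (j, k)" and k: "k \<in> P" "ar j \<subseteq> ar k"
      by (auto simp: poset_cat_def hom_def r_def)
    have "arrow_of (copy (ar i)) ((emb (ar k) \<circ> inv_into (ar j) (emb (ar j))) \<circ>
          (emb (ar j) \<circ> inv_into (ar i) (emb (ar i)))) (copy (ar k)) =
        arrow_of (copy (ar i)) (emb (ar k) \<circ> inv_into (ar i) (emb (ar i))) (copy (ar k))"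
    proof (rule arrow_of_cong[OF small_ncatsD(2)[OF copy_small[OF S]]])
      fix f assume "f \<in> Arr (copy (ar i))"
      then obtain g where "g \<in> ar i" "f = emb (ar i) g" unfolding copy_Arr[OF S] by blast
      then show "((emb (ar k) \<circ> inv_into (ar j) (emb (ar j))) \<circ> (emb (ar j) \<circ> inv_into (ar i) (emb (ar i)))) f =
          (emb (ar k) \<circ> inv_into (ar i) (emb (ar i))) f"
        using inv[OF S] inv[OF T] ij(3) by auto
    qed
    then show "ArrMap D (Comp (poset_cat P r) v u) = Comp Cat_normed (ArrMap D v) (ArrMap D u)"
      using Comp_arrow_of[OF small_ncatsD(2)[OF copy_small[OF S]] small_ncatsD(2)[OF copy_small[OF T]]
          arrfun_D[OF S T ij(3)]]
      unfolding u v by (simp add: D_def poset_cat_def)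
  qed
  interpret dd: directed_diagram P r D K
    by (rule directed_diagramI[OF lam K_inf K_values dir is_fun])
  define t where "t i = arrow_of (copy (ar i)) (inv_into (ar i) (emb (ar i))) X" for i
  have E: "ObjMap D i = copy (ar i)" for i by (simp add: D_def)
  have t: "t i \<in> hom Cat_normed (ObjMap D i) X" if "i \<in> P" for i
    unfolding t_def E
    by (rule hom_Cat_normedI[OF copy_small[OF ar(1)[OF that]] X_small arrfun_copy_incl[OF ar(1)[OF that]]])
  have t_arr: "arrmap (t i) (emb (ar i) f) = f" if "i \<in> P" "f \<in> ar i" for i f
    unfolding t_def using that inv[OF ar(1)[OF that(1)]] copy_Arr[OF ar(1)[OF that(1)]]
    by (subst arrmap_arrow_of) auto
  have M_arr: "arrmap (ArrMap D (i, j)) (emb (ar i) f) = emb (ar j) f" if "i \<in> P" "f \<in> ar i" for i j f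
    unfolding D_def using that inv[OF ar(1)[OF that(1)]] copy_Arr[OF ar(1)[OF that(1)]]
    by (simp, subst arrmap_arrow_of) auto
  have comp: "dd.compatible (\<lambda>i. arrmap (t i))"
    unfolding dd.compatible_def
  proof (intro allI impI ballI)
    fix i j f assume "(i, j) \<in> r" and f: "f \<in> Arr (ObjMap D i)"
    then have ij: "i \<in> P" "j \<in> P" "ar i \<subseteq> ar j" unfolding r_def by auto
    obtain g where "g \<in> ar i" "f = emb (ar i) g" using f unfolding E copy_Arr[OF ar(1)[OF ij(1)]] by blast
    then show "arrmap (t j) (arrmap (ArrMap D (i, j)) f) = arrmap (t i) f"
      using M_arr[OF ij(1)] t_arr[OF ij(1)] t_arr[OF ij(2)] ij(3) by auto
  qed
  have "dd.separating (\<lambda>i. arrmap (t i))"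
    unfolding dd.separating_def
  proof (intro conjI comp ballI impI)
    fix i f g assume i: "i \<in> P" and fg: "f \<in> Arr (ObjMap D i)" "g \<in> Arr (ObjMap D i)"
      and eq: "arrmap (t i) f = arrmap (t i) g"
    obtain f' g' where "f' \<in> ar i" "f = emb (ar i) f'" "g' \<in> ar i" "g = emb (ar i) g'"
      using fg unfolding E copy_Arr[OF ar(1)[OF i]] by blast
    then have "f = g" using eq t_arr[OF i] by auto
    then show "\<exists>j. (i, j) \<in> r \<and> arrmap (ArrMap D (i, j)) f = arrmap (ArrMap D (i, j)) g"
      using dd.r_refl[OF i] by blast
  qed
  moreover have "\<exists>i\<in>P. \<exists>f\<in>Arr (ObjMap D i). arrmap (t i) f = p \<and> nrm X p \<le> nrm (ObjMap D i) f"
    if p: "p \<in> Arr X" for p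
  proof -
    \<comment> \<open>A closed set containing \<open>p\<close> supplies a representative with the
      norm of \<open>p\<close>.\<close>
    have "|{p}| \<le>o |K|"
      using K_inf by (intro ordLess_imp_ordLeq finite_ordLess_infinite) (auto simp: Field_card_of card_of_well_order_on)
    then obtain S where S: "S \<in> closed_sets" "p \<in> S" using ex_closed_set[of "{p}"] p by auto
    show ?thesis
      using idx_P[OF S(1)] t_arr[of "idx S" p] copy_Arr[OF S(1)] copy_nrm[OF S] S(2)
      by (intro bexI[of _ "idx S"] bexI[of _ "emb S p"]) (auto simp: E)
  qed
  ultimately have "dd.concrete X t"
    unfolding dd.concrete_def using dd.is_coconeI[OF X_small t comp] by blast
  then have "is_colimit (poset_cat P r) Cat_normed D X t" by (rule dd.concrete_is_colimit)
  moreover have "\<forall>i\<in>P. ObjMap D i \<in> {Y \<in> small_ncats. Obj Y \<subseteq> emb0 ` K \<and> Arr Y \<subseteq> emb0 ` K}"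
  proof
    fix i assume "i \<in> P"
    note S = ar(1)[OF this]
    show "ObjMap D i \<in> {Y \<in> small_ncats. Obj Y \<subseteq> emb0 ` K \<and> Arr Y \<subseteq> emb0 ` K}"
      unfolding E using copy_small[OF S] copy_Obj[OF S] copy_Arr[OF S] emb(2)[OF S] by auto
  qed
  ultimately show ?thesis using P_small dir is_fun by blast
qed

end

theorem corollary13p3:
  assumes "universe TYPE('u)"
    and "small TYPE('u) (UNIV :: 'v::quantale set)"
  shows "locally_presentable TYPE('u)
    (Cat_normed :: (('u, 'u, 'v) ncat,
       ('u, 'u, 'v) ncat \<times> ('u, 'u, 'u, 'u) functor_map \<times> ('u, 'u, 'v) ncat) cat)"
proof -
  note U = assms(1)
  \<comment> \<open>The summand \<open>'v\<close> makes this set as large as the set of values of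
    the norm, the summand \<open>nat\<close> makes it infinite.\<close>
  let ?K = "UNIV <+> UNIV :: ('v + nat) set"
  let ?C = "Cat_normed :: (('u, 'u, 'v) ncat,
       ('u, 'u, 'v) ncat \<times> ('u, 'u, 'u, 'u) functor_map \<times> ('u, 'u, 'v) ncat) cat"
  have K: "small TYPE('u) ?K" by (rule small_Plus[OF U assms(2) small_nat[OF U]])
  have K_inf: "infinite ?K" by (simp add: finite_Plus_iff)
  have K_values: "|UNIV :: 'v set| \<le>o |?K|" by (rule card_of_Plus1)
  obtain lam :: "'u rel" where lam: "Cinfinite lam" "regularCard lam" "lam <o |UNIV :: 'u set|" "lam =o cardSuc |?K|"
    using ex_small_cardSuc[OF U K K_inf] by blast
  obtain emb0 :: "'v + nat \<Rightarrow> 'u" where emb0: "inj_on emb0 ?K" using small_ex_inj[OF K] by blast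
  \<comment> \<open>Up to isomorphism these are the normed categories with at most
    \<open>|?K|\<close> arrows.\<close>
  define A where "A = {Y :: ('u, 'u, 'v) ncat. Y \<in> small_ncats \<and> Obj Y \<subseteq> emb0 ` ?K \<and> Arr Y \<subseteq> emb0 ` ?K}"
  have "locally_presentable_for TYPE('u) lam ?C"
    unfolding locally_presentable_for_def
  proof (intro conjI category_Cat_normed locally_small_Cat_normed[OF U] cocomplete_Cat_normed[OF U]
      exI[of _ A] ballI)
    show "A \<subseteq> Obj ?C" by (auto simp: A_def)
    show "small TYPE('u) A" unfolding A_def by (rule small_ncats_on[OF U small_image[OF K] assms(2)])
    fix Y assume "Y \<in> A"
    then have Y: "Y \<in> small_ncats" "Arr Y \<subseteq> emb0 ` ?K" by (auto simp: A_def)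
    have "|Arr Y| \<le>o |?K|" by (rule ordLeq_transitive[OF card_of_mono1[OF Y(2)] card_of_image])
    then show "presentable_object TYPE('u) lam ?C Y"
      by (rule presentable_objectI[OF U lam(4) K_inf K_values Y(1)])
  next
    fix X assume "X \<in> Obj ?C"
    then have "X \<in> small_ncats" by simp
    then interpret small_subcats X ?K emb0 using U K_inf emb0 by unfold_locales
    show "\<exists>(P :: 'u set) r D t. small TYPE('u) P \<and> directed_poset lam P r \<and>
        is_functor (poset_cat P r) ?C D \<and> (\<forall>i\<in>P. ObjMap D i \<in> A) \<and> is_colimit (poset_cat P r) ?C D X t"
      unfolding A_def by (rule ex_directed_colimit[OF lam(4) K_values])
  qed
  then show ?thesis unfolding locally_presentable_def using lam by blast
qed

end
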